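(* Let $\mathrm{BI}_{120}$ be the binary icosahedral group and let $G=\mathcal{C}(\mathrm{BI}_{120},\Gamma)$ be a commuting graph on $\mathrm{BI}_{120}$. Then, up to isomorphism, $$G=\begin{cases}K_2 & \text{when }\Gamma=\mathcal{B}_i\text{ for } i=1,\ldots,16,\\ K_4 & \text{when }\Gamma=\mathcal{C}_i\text{ for } i=1,\ldots,10,\\ K_8 & \text{when }\Gamma=\mathcal{D}_i\text{ for } i=1,\ldots,6,\\ K_2\vee(15K_2\cup 10K_4\cup 6K_8) & \text{when }\Gamma=\mathrm{BI}_{120}.\end{cases}$$
   Context: The binary icosahedral group, of order 120, is presented as $\mathrm{BI}_{120}=\langle r,s,t\mid r^2=s^3=t^5=rst\rangle$. Consider the following subsets of $\mathrm{BI}_{120}$: $\mathcal{B}_1=Z(\mathrm{BI}_{120})=\{1,r^2\}$ (the center), $\mathcal{B}_2=\{r,r^{-1}\}$, $\mathcal{B}_3=\{ts,s^{-1}t^{-1}\}$, $\mathcal{B}_4=\{s^{-1}ts^{-1},st^{-1}s\}$, $\mathcal{B}_5=\{r^{-1}(tsr)^2,(rts)^2r\}$, $\mathcal{B}_6=\{s^{-1}t^2srts,(srt)^2s\}$, $\mathcal{B}_7=\{t^{-1}r^{-1}tsrts,t^{-1}(rts)^2\}$, $\mathcal{B}_8=\{st^{-1}r^{-1}tsr,st^{-1}rtsr\}$, $\mathcal{B}_9=\{st^{-1}r^{-1}t^2s,st^{-1}rt^2s\}$, $\mathcal{B}_{10}=\{t^{-1}r^{-1}tsrt,t^{-1}rtsrt\}$,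 $\mathcal{B}_{11}=\{tsrts,s^{-1}t^{-1}rts\}$, $\mathcal{B}_{12}=\{t^2srt,ts^{-1}t^{-1}rt\}$, $\mathcal{B}_{13}=\{st^{-1}rts^{-1},st^{-1}r^{-1}ts^{-1}\}$, $\mathcal{B}_{14}=\{t^2st^{-1},ts^{-1}t^{-2}\}$, $\mathcal{B}_{15}=\{rtsr,r^{-1}tsr\}$, $\mathcal{B}_{16}=\{t^{-1}r^{-1}t,t^{-1}rt\}$; $\mathcal{C}_1=\{s,s^{-1},s^{-2},tr\}$, $\mathcal{C}_2=\{rt,r^{-1}t,t^{-1}r^{-1},t^{-1}r\}$, $\mathcal{C}_3=\{s^{-1}t^{-2},ts^{-1}t^{-1},tst^{-1},t^2s\}$, $\mathcal{C}_4=\{t^{-1}rt^2s,s^{-1}t^2sr,srtsr,t^{-1}r^{-1}t^2s\}$, $\mathcal{C}_5=\{ts^{-1}t^{-2}r,st^{-1}r^{-1}ts,st^{-1}rts,t^2st^{-1}r\}$, $\mathcal{C}_6=\{t^{-1}r^{-1}t^2,t^{-1}rt^2,ts^{-1}t^{-1}r,t^2sr\}$, $\mathcal{C}_7=\{ts^{-1}t^{-2}s,st^{-1}r^{-1}t^2,st^{-1}rt^2,t^2st^{-1}s\}$, $\mathcal{C}_8=\{st^{-1}r^{-1}t,st^{-1}rt,t^{-1}r^{-1}ts^{-1},t^{-1}rts^{-1}\}$, $\mathcal{C}_9=\{t^{-1}r^{-1}ts,s^{-1}t^{-1}rt,t^{-1}rts,tsrt\}$, $\mathcal{C}_{10}=\{tst^{-1}r,r^{-1}t^2s,rt^2s,s^{-1}t^{-2}r\}$;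 $\mathcal{D}_1=\{t,t^{-1},rs,s^{-1}r^{-1},t^{-2},t^2,s^{-1}r^{-1}t,t^{-1}rs\}$, $\mathcal{D}_2=\{sr,r^{-1}s^{-1},s^{-1}t,t^{-1}s,r^{-1}ts^{-1},rts^{-1},st^{-1}r^{-1},st^{-1}r\}$, $\mathcal{D}_3=\{srs,st^{-1},ts^{-1},t^2r,s^{-1}t^{-2}s,s^{-1}t^2s,srts,tst^{-1}s\}$, $\mathcal{D}_4=\{tsr,r^{-1}ts,rts,s^{-1}t^{-1}r,r^{-1}tsrts,(rts)^2,s^{-1}t^{-1}rtsr,(tsr)^2\}$, $\mathcal{D}_5=\{r^{-1}t^2,rt^2,t^{-2}r^{-1},t^{-2}r,r^{-1}tsrt,rtsrt,t^{-1}r^{-1}tsr,t^{-1}rtsr\}$, $\mathcal{D}_6=\{srt,s^{-1}t^2,t^{-1}r^{-1}s^{-1},t^{-2}s,s^{-1}t^2srt,(srt)^2,ts^{-1}t^{-1}rts,t^2srts\}$. For a group $H$ and a nonempty subset $\Gamma\subseteq H$, $\mathcal{C}(H,\Gamma)$ is the simple graph with node set $\Gamma$ in which two distinct elements are joined by an edge if and only if they commute in $H$. $K_m$ is the complete graph on $m$ nodes, $rK_m$ (for an integer $r$) is the graph consisting of $r$ (disjoint) copies of $K_m$, $\cup$ denotes disjoint union of graphs, and the join $G_1\vee G_2$ is the graph with node set $V(G_1)\cup V(G_2)$ and edge set $E(G_1)\cup E(G_2)\cup\{y\sim z: y\in V(G_1),z\in V(G_2)\}$. *)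

theory Defs
  imports "HOL-Algebra.Group"
begin

section \<open>Groups given by generators and relations\<close>

text \<open>A group word over generators \<open>'a\<close>: the letter \<open>(x, True)\<close> stands for \<open>x\<close> and
  \<open>(x, False)\<close> for the inverse of \<open>x\<close>. A relation \<open>u = v\<close> is a pair of words.\<close>

type_synonym 'a gword = "('a \<times> bool) list"

inductive word_eq :: "('a gword \<times> 'a gword) set \<Rightarrow> 'a gword \<Rightarrow> 'a gword \<Rightarrow> bool"
  for Rel :: "('a gword \<times> 'a gword) set" where
  relator: "(u, v) \<in> Rel \<Longrightarrow> word_eq Rel u v"
| cancel: "word_eq Rel [(x, b), (x, \<not> b)] []"
| refl: "word_eq Rel u u"
| sym: "word_eq Rel u v \<Longrightarrow> word_eq Rel v u"
| trans: "word_eq Rel u v \<Longrightarrow> word_eq Rel v w \<Longrightarrow> word_eq Rel u w"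
| cong: "word_eq Rel u v \<Longrightarrow> word_eq Rel (p @ u @ q) (p @ v @ q)"

definition word_class :: "('a gword \<times> 'a gword) set \<Rightarrow> 'a gword \<Rightarrow> 'a gword set" where
  "word_class Rel w = {v. word_eq Rel w v}"

text \<open>All elements of the type \<open>'a\<close> serve as generators.\<close>

definition presented_group :: "('a gword \<times> 'a gword) set \<Rightarrow> 'a gword set monoid" where
  "presented_group Rel =
     \<lparr>carrier = range (word_class Rel),
      mult = (\<lambda>A B. \<Union>a\<in>A. \<Union>b\<in>B. word_class Rel (a @ b)),
      one = word_class Rel []\<rparr>"

lemma word_class_eq_iff: "word_class Rel u = word_class Rel v \<longleftrightarrow> word_eq Rel u v"
  unfolding word_class_def by (blast intro: word_eq.refl word_eq.sym word_eq.trans)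

lemma word_eq_append:
  assumes "word_eq Rel u u'" "word_eq Rel v v'"
  shows "word_eq Rel (u @ v) (u' @ v')"
  using word_eq.cong[OF assms(1), of "[]" v] word_eq.cong[OF assms(2), of u' "[]"]
  by (auto intro: word_eq.trans)

lemma mult_word_class:
  "word_class Rel u \<otimes>\<^bsub>presented_group Rel\<^esub> word_class Rel v = word_class Rel (u @ v)"
proof -
  have *: "word_class Rel (a @ b) = word_class Rel (u @ v)"
    if "a \<in> word_class Rel u" "b \<in> word_class Rel v" for a b
    using that by (simp add: word_class_def[of Rel u] word_class_def[of Rel v]
        word_class_eq_iff word_eq.sym word_eq_append)
  have "u \<in> word_class Rel u" "v \<in> word_class Rel v"
    by (simp_all add: word_class_def word_eq.refl)
  then have "(\<Union>a\<in>word_class Rel u. \<Union>b\<in>word_class Rel v. word_class Rel (a @ b))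
      = (\<Union>a\<in>word_class Rel u. \<Union>b\<in>word_class Rel v. word_class Rel (u @ v))"
    by (intro SUP_cong refl *) auto
  also have "\<dots> = word_class Rel (u @ v)"
    using \<open>u \<in> word_class Rel u\<close> \<open>v \<in> word_class Rel v\<close> by auto
  finally show ?thesis
    by (simp add: presented_group_def)
qed

definition inv_word :: "'a gword \<Rightarrow> 'a gword" where
  "inv_word w = rev (map (\<lambda>(x, b). (x, \<not> b)) w)"

lemma inv_word_append: "word_eq Rel (inv_word w @ w) []"
proof (induction w)
  case Nil
  show ?case by (simp add: inv_word_def word_eq.refl)
next
  case (Cons l w)
  obtain x b where l: "l = (x, b)" by (cases l)
  have "word_eq Rel (inv_word w @ [(x, \<not> b), (x, \<not> \<not> b)] @ w) (inv_word w @ [] @ w)"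
    by (intro word_eq.cong word_eq.cancel)
  with Cons.IH show ?case
    by (auto simp: inv_word_def l intro: word_eq.trans)
qed

lemma group_presented_group: "group (presented_group Rel)"
proof (rule groupI)
  let ?G = "presented_group Rel"
  have carr: "carrier ?G = range (word_class Rel)" and one: "\<one>\<^bsub>?G\<^esub> = word_class Rel []"
    by (simp_all add: presented_group_def)
  show "x \<otimes>\<^bsub>?G\<^esub> y \<in> carrier ?G" if "x \<in> carrier ?G" "y \<in> carrier ?G" for x y
    using that by (auto simp: carr mult_word_class)
  show "\<one>\<^bsub>?G\<^esub> \<in> carrier ?G" by (simp add: carr one)
  show "x \<otimes>\<^bsub>?G\<^esub> y \<otimes>\<^bsub>?G\<^esub> z = x \<otimes>\<^bsub>?G\<^esub> (y \<otimes>\<^bsub>?G\<^esub> z)"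
    if "x \<in> carrier ?G" "y \<in> carrier ?G" "z \<in> carrier ?G" for x y z
    using that by (auto simp: carr mult_word_class)
  show "\<one>\<^bsub>?G\<^esub> \<otimes>\<^bsub>?G\<^esub> x = x" if "x \<in> carrier ?G" for x
    using that by (auto simp: carr one mult_word_class)
  show "\<exists>y\<in>carrier ?G. y \<otimes>\<^bsub>?G\<^esub> x = \<one>\<^bsub>?G\<^esub>" if "x \<in> carrier ?G" for x
  proof -
    obtain w where w: "x = word_class Rel w"
      using \<open>x \<in> carrier ?G\<close> by (auto simp: carr)
    have "word_class Rel (inv_word w) \<otimes>\<^bsub>?G\<^esub> x = \<one>\<^bsub>?G\<^esub>"
      by (simp add: w one mult_word_class word_class_eq_iff inv_word_append)
    then show ?thesis by (auto simp: carr)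
  qed
qed


section \<open>The binary icosahedral group\<close>

datatype bi_gen = gen_r | gen_s | gen_t

definition bi_relations :: "(bi_gen gword \<times> bi_gen gword) set" where
  "bi_relations =
     (let r = (gen_r, True); s = (gen_s, True); t = (gen_t, True) in
      {([r, r], [r, s, t]), ([s, s, s], [r, s, t]), ([t, t, t, t, t], [r, s, t])})"

definition BI120 :: "bi_gen gword set monoid" where
  "BI120 = presented_group bi_relations"

definition bi_elem :: "bi_gen \<Rightarrow> bi_gen gword set" where
  "bi_elem g = word_class bi_relations [(g, True)]"

abbreviation bi_r ("\<r>") where "\<r> \<equiv> bi_elem gen_r"
abbreviation bi_s ("\<s>") where "\<s> \<equiv> bi_elem gen_s"
abbreviation bi_t ("\<t>") where "\<t> \<equiv> bi_elem gen_t"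

abbreviation bi_mult (infixl "\<cdot>" 70) where
  "x \<cdot> y \<equiv> x \<otimes>\<^bsub>BI120\<^esub> y"

abbreviation bi_power (infixr "\<up>" 75) where
  "x \<up> k \<equiv> x [^]\<^bsub>BI120\<^esub> (k :: int)"

text \<open>The first member of \<open>B_sets\<close> is the centre of the group.\<close>

definition B_sets :: "bi_gen gword set set list" where
  "B_sets = [
      {\<one>\<^bsub>BI120\<^esub>, \<r> \<up> 2},
      {\<r>, \<r> \<up> -1},
      {\<t> \<cdot> \<s>, \<s> \<up> -1 \<cdot> \<t> \<up> -1},
      {\<s> \<up> -1 \<cdot> \<t> \<cdot> \<s> \<up> -1, \<s> \<cdot> \<t> \<up> -1 \<cdot> \<s>},
      {\<r> \<up> -1 \<cdot> (\<t> \<cdot> \<s> \<cdot> \<r>) \<up> 2, (\<r> \<cdot> \<t> \<cdot> \<s>) \<up> 2 \<cdot> \<r>},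
      {\<s> \<up> -1 \<cdot> \<t> \<up> 2 \<cdot> \<s> \<cdot> \<r> \<cdot> \<t> \<cdot> \<s>, (\<s> \<cdot> \<r> \<cdot> \<t>) \<up> 2 \<cdot> \<s>},
      {\<t> \<up> -1 \<cdot> \<r> \<up> -1 \<cdot> \<t> \<cdot> \<s> \<cdot> \<r> \<cdot> \<t> \<cdot> \<s>, \<t> \<up> -1 \<cdot> (\<r> \<cdot> \<t> \<cdot> \<s>) \<up> 2},
      {\<s> \<cdot> \<t> \<up> -1 \<cdot> \<r> \<up> -1 \<cdot> \<t> \<cdot> \<s> \<cdot> \<r>, \<s> \<cdot> \<t> \<up> -1 \<cdot> \<r> \<cdot> \<t> \<cdot> \<s> \<cdot> \<r>},
      {\<s> \<cdot> \<t> \<up> -1 \<cdot> \<r> \<up> -1 \<cdot> \<t> \<up> 2 \<cdot> \<s>, \<s> \<cdot> \<t> \<up> -1 \<cdot> \<r> \<cdot> \<t> \<up> 2 \<cdot> \<s>},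
      {\<t> \<up> -1 \<cdot> \<r> \<up> -1 \<cdot> \<t> \<cdot> \<s> \<cdot> \<r> \<cdot> \<t>, \<t> \<up> -1 \<cdot> \<r> \<cdot> \<t> \<cdot> \<s> \<cdot> \<r> \<cdot> \<t>},
      {\<t> \<cdot> \<s> \<cdot> \<r> \<cdot> \<t> \<cdot> \<s>, \<s> \<up> -1 \<cdot> \<t> \<up> -1 \<cdot> \<r> \<cdot> \<t> \<cdot> \<s>},
      {\<t> \<up> 2 \<cdot> \<s> \<cdot> \<r> \<cdot> \<t>, \<t> \<cdot> \<s> \<up> -1 \<cdot> \<t> \<up> -1 \<cdot> \<r> \<cdot> \<t>},
      {\<s> \<cdot> \<t> \<up> -1 \<cdot> \<r> \<cdot> \<t> \<cdot> \<s> \<up> -1, \<s> \<cdot> \<t> \<up> -1 \<cdot> \<r> \<up> -1 \<cdot> \<t> \<cdot> \<s> \<up> -1},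
      {\<t> \<up> 2 \<cdot> \<s> \<cdot> \<t> \<up> -1, \<t> \<cdot> \<s> \<up> -1 \<cdot> \<t> \<up> -2},
      {\<r> \<cdot> \<t> \<cdot> \<s> \<cdot> \<r>, \<r> \<up> -1 \<cdot> \<t> \<cdot> \<s> \<cdot> \<r>},
      {\<t> \<up> -1 \<cdot> \<r> \<up> -1 \<cdot> \<t>, \<t> \<up> -1 \<cdot> \<r> \<cdot> \<t>}]"

definition C_sets :: "bi_gen gword set set list" where
  "C_sets = [
      {\<s>, \<s> \<up> -1, \<s> \<up> -2, \<t> \<cdot> \<r>},
      {\<r> \<cdot> \<t>, \<r> \<up> -1 \<cdot> \<t>, \<t> \<up> -1 \<cdot> \<r> \<up> -1, \<t> \<up> -1 \<cdot> \<r>},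
      {\<s> \<up> -1 \<cdot> \<t> \<up> -2, \<t> \<cdot> \<s> \<up> -1 \<cdot> \<t> \<up> -1, \<t> \<cdot> \<s> \<cdot> \<t> \<up> -1, \<t> \<up> 2 \<cdot> \<s>},
      {\<t> \<up> -1 \<cdot> \<r> \<cdot> \<t> \<up> 2 \<cdot> \<s>, \<s> \<up> -1 \<cdot> \<t> \<up> 2 \<cdot> \<s> \<cdot> \<r>, \<s> \<cdot> \<r> \<cdot> \<t> \<cdot> \<s> \<cdot> \<r>,
       \<t> \<up> -1 \<cdot> \<r> \<up> -1 \<cdot> \<t> \<up> 2 \<cdot> \<s>},
      {\<t> \<cdot> \<s> \<up> -1 \<cdot> \<t> \<up> -2 \<cdot> \<r>, \<s> \<cdot> \<t> \<up> -1 \<cdot> \<r> \<up> -1 \<cdot> \<t> \<cdot> \<s>, \<s> \<cdot> \<t> \<up> -1 \<cdot> \<r> \<cdot> \<t> \<cdot> \<s>,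
       \<t> \<up> 2 \<cdot> \<s> \<cdot> \<t> \<up> -1 \<cdot> \<r>},
      {\<t> \<up> -1 \<cdot> \<r> \<up> -1 \<cdot> \<t> \<up> 2, \<t> \<up> -1 \<cdot> \<r> \<cdot> \<t> \<up> 2, \<t> \<cdot> \<s> \<up> -1 \<cdot> \<t> \<up> -1 \<cdot> \<r>, \<t> \<up> 2 \<cdot> \<s> \<cdot> \<r>},
      {\<t> \<cdot> \<s> \<up> -1 \<cdot> \<t> \<up> -2 \<cdot> \<s>, \<s> \<cdot> \<t> \<up> -1 \<cdot> \<r> \<up> -1 \<cdot> \<t> \<up> 2, \<s> \<cdot> \<t> \<up> -1 \<cdot> \<r> \<cdot> \<t> \<up> 2,
       \<t> \<up> 2 \<cdot> \<s> \<cdot> \<t> \<up> -1 \<cdot> \<s>},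
      {\<s> \<cdot> \<t> \<up> -1 \<cdot> \<r> \<up> -1 \<cdot> \<t>, \<s> \<cdot> \<t> \<up> -1 \<cdot> \<r> \<cdot> \<t>, \<t> \<up> -1 \<cdot> \<r> \<up> -1 \<cdot> \<t> \<cdot> \<s> \<up> -1,
       \<t> \<up> -1 \<cdot> \<r> \<cdot> \<t> \<cdot> \<s> \<up> -1},
      {\<t> \<up> -1 \<cdot> \<r> \<up> -1 \<cdot> \<t> \<cdot> \<s>, \<s> \<up> -1 \<cdot> \<t> \<up> -1 \<cdot> \<r> \<cdot> \<t>, \<t> \<up> -1 \<cdot> \<r> \<cdot> \<t> \<cdot> \<s>, \<t> \<cdot> \<s> \<cdot> \<r> \<cdot> \<t>},
      {\<t> \<cdot> \<s> \<cdot> \<t> \<up> -1 \<cdot> \<r>, \<r> \<up> -1 \<cdot> \<t> \<up> 2 \<cdot> \<s>, \<r> \<cdot> \<t> \<up> 2 \<cdot> \<s>, \<s> \<up> -1 \<cdot> \<t> \<up> -2 \<cdot> \<r>}]"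

definition D_sets :: "bi_gen gword set set list" where
  "D_sets = [
      {\<t>, \<t> \<up> -1, \<r> \<cdot> \<s>, \<s> \<up> -1 \<cdot> \<r> \<up> -1, \<t> \<up> -2, \<t> \<up> 2, \<s> \<up> -1 \<cdot> \<r> \<up> -1 \<cdot> \<t>,
       \<t> \<up> -1 \<cdot> \<r> \<cdot> \<s>},
      {\<s> \<cdot> \<r>, \<r> \<up> -1 \<cdot> \<s> \<up> -1, \<s> \<up> -1 \<cdot> \<t>, \<t> \<up> -1 \<cdot> \<s>, \<r> \<up> -1 \<cdot> \<t> \<cdot> \<s> \<up> -1, \<r> \<cdot> \<t> \<cdot> \<s> \<up> -1,
       \<s> \<cdot> \<t> \<up> -1 \<cdot> \<r> \<up> -1, \<s> \<cdot> \<t> \<up> -1 \<cdot> \<r>},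
      {\<s> \<cdot> \<r> \<cdot> \<s>, \<s> \<cdot> \<t> \<up> -1, \<t> \<cdot> \<s> \<up> -1, \<t> \<up> 2 \<cdot> \<r>, \<s> \<up> -1 \<cdot> \<t> \<up> -2 \<cdot> \<s>,
       \<s> \<up> -1 \<cdot> \<t> \<up> 2 \<cdot> \<s>, \<s> \<cdot> \<r> \<cdot> \<t> \<cdot> \<s>, \<t> \<cdot> \<s> \<cdot> \<t> \<up> -1 \<cdot> \<s>},
      {\<t> \<cdot> \<s> \<cdot> \<r>, \<r> \<up> -1 \<cdot> \<t> \<cdot> \<s>, \<r> \<cdot> \<t> \<cdot> \<s>, \<s> \<up> -1 \<cdot> \<t> \<up> -1 \<cdot> \<r>,
       \<r> \<up> -1 \<cdot> \<t> \<cdot> \<s> \<cdot> \<r> \<cdot> \<t> \<cdot> \<s>, (\<r> \<cdot> \<t> \<cdot> \<s>) \<up> 2, \<s> \<up> -1 \<cdot> \<t> \<up> -1 \<cdot> \<r> \<cdot> \<t> \<cdot> \<s> \<cdot> \<r>,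
       (\<t> \<cdot> \<s> \<cdot> \<r>) \<up> 2},
      {\<r> \<up> -1 \<cdot> \<t> \<up> 2, \<r> \<cdot> \<t> \<up> 2, \<t> \<up> -2 \<cdot> \<r> \<up> -1, \<t> \<up> -2 \<cdot> \<r>, \<r> \<up> -1 \<cdot> \<t> \<cdot> \<s> \<cdot> \<r> \<cdot> \<t>,
       \<r> \<cdot> \<t> \<cdot> \<s> \<cdot> \<r> \<cdot> \<t>, \<t> \<up> -1 \<cdot> \<r> \<up> -1 \<cdot> \<t> \<cdot> \<s> \<cdot> \<r>, \<t> \<up> -1 \<cdot> \<r> \<cdot> \<t> \<cdot> \<s> \<cdot> \<r>},
      {\<s> \<cdot> \<r> \<cdot> \<t>, \<s> \<up> -1 \<cdot> \<t> \<up> 2, \<t> \<up> -1 \<cdot> \<r> \<up> -1 \<cdot> \<s> \<up> -1, \<t> \<up> -2 \<cdot> \<s>,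
       \<s> \<up> -1 \<cdot> \<t> \<up> 2 \<cdot> \<s> \<cdot> \<r> \<cdot> \<t>, (\<s> \<cdot> \<r> \<cdot> \<t>) \<up> 2, \<t> \<cdot> \<s> \<up> -1 \<cdot> \<t> \<up> -1 \<cdot> \<r> \<cdot> \<t> \<cdot> \<s>,
       \<t> \<up> 2 \<cdot> \<s> \<cdot> \<r> \<cdot> \<t> \<cdot> \<s>}]"

text \<open>The families are indexed from \<open>1\<close>; \<open>B_set i\<close>, \<open>C_set i\<close>, \<open>D_set i\<close> are only meaningful for
  \<open>1 \<le> i \<le> 16\<close>, \<open>1 \<le> i \<le> 10\<close> and \<open>1 \<le> i \<le> 6\<close>, respectively.\<close>

definition B_set :: "nat \<Rightarrow> bi_gen gword set set" where "B_set i = B_sets ! (i - 1)"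
definition C_set :: "nat \<Rightarrow> bi_gen gword set set" where "C_set i = C_sets ! (i - 1)"
definition D_set :: "nat \<Rightarrow> bi_gen gword set set" where "D_set i = D_sets ! (i - 1)"


section \<open>Simple graphs\<close>

text \<open>Edges are two-element sets of nodes.\<close>

record 'a sgraph =
  nodes :: "'a set"
  edges :: "'a set set"

definition graph_iso :: "'a sgraph \<Rightarrow> 'b sgraph \<Rightarrow> bool" (infix "\<simeq>\<^sub>g" 50) where
  "G \<simeq>\<^sub>g H \<longleftrightarrow>
     (\<exists>f. bij_betw f (nodes G) (nodes H) \<and>
          (\<forall>x\<in>nodes G. \<forall>y\<in>nodes G. {x, y} \<in> edges G \<longleftrightarrow> {f x, f y} \<in> edges H))"

definition complete_graph :: "nat \<Rightarrow> nat sgraph" ("K\<^bsub>_\<^esub>") where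
  "K\<^bsub>m\<^esub> = \<lparr>nodes = {..<m}, edges = {{x, y} | x y. x < m \<and> y < m \<and> x \<noteq> y}\<rparr>"

definition graph_copies :: "nat \<Rightarrow> 'a sgraph \<Rightarrow> (nat \<times> 'a) sgraph" (infixr "\<odot>\<^sub>g" 75) where
  "k \<odot>\<^sub>g G = \<lparr>nodes = {..<k} \<times> nodes G, edges = {Pair i ` e | i e. i < k \<and> e \<in> edges G}\<rparr>"

definition graph_union :: "'a sgraph \<Rightarrow> 'b sgraph \<Rightarrow> ('a + 'b) sgraph" (infixl "\<union>\<^sub>g" 65) where
  "G \<union>\<^sub>g H =
     \<lparr>nodes = nodes G <+> nodes H, edges = (image Inl ` edges G) \<union> (image Inr ` edges H)\<rparr>"

text \<open>The node sets of the two joined graphs are made disjoint by tagging.\<close>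

definition graph_join :: "'a sgraph \<Rightarrow> 'b sgraph \<Rightarrow> ('a + 'b) sgraph" (infixl "\<or>\<^sub>g" 60) where
  "G \<or>\<^sub>g H =
     \<lparr>nodes = nodes G <+> nodes H,
      edges = (image Inl ` edges G) \<union> (image Inr ` edges H) \<union>
              {{Inl y, Inr z} | y z. y \<in> nodes G \<and> z \<in> nodes H}\<rparr>"

definition commuting_graph :: "('a, 'm) monoid_scheme \<Rightarrow> 'a set \<Rightarrow> 'a sgraph" where
  "commuting_graph H \<Gamma> =
     \<lparr>nodes = \<Gamma>,
      edges = {{x, y} | x y. x \<in> \<Gamma> \<and> y \<in> \<Gamma> \<and> x \<noteq> y \<and> x \<otimes>\<^bsub>H\<^esub> y = y \<otimes>\<^bsub>H\<^esub> x}\<rparr>"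

end

theory Submission
  imports Defs "HOL-Computational_Algebra.Primes"
begin

text \<open>The relations amount to \<open>s t s = t\<^sup>4\<close>, \<open>t s t = s\<^sup>2\<close>, \<open>s\<^sup>3 = t\<^sup>5\<close> with \<open>r = s t\<close>. They give twelve
  cosets of the subgroup generated by \<open>t\<close>, and the representative \<open>y = s t\<^sup>3 s t\<^sup>4 s\<close> of the last one satisfies
  \<open>y t = t\<^sup>-\<^sup>1 y\<close>; as \<open>t\<^sup>5\<close> is central, \<open>t\<^sup>1\<^sup>0 = 1\<close>, so there are at most 120 elements. They have
  different images in \<open>SL(2, 5)\<close>, which is therefore a faithful model of the group. Two noncentral
  matrices with rows \<open>(a, b)\<close> and \<open>(c, d)\<close> commute iff their vectors \<open>(a - d, b, c)\<close> are
  proportional, so commuting is an equivalence relation on the noncentral elements, and it is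
  enough to compare one representative of each of the 31 sets.\<close>

section \<open>Commuting graphs\<close>

lemma commuting_graph_edge_iff:
  assumes "x \<in> \<Gamma>" "y \<in> \<Gamma>"
  shows "{x, y} \<in> edges (commuting_graph H \<Gamma>) \<longleftrightarrow> x \<noteq> y \<and> x \<otimes>\<^bsub>H\<^esub> y = y \<otimes>\<^bsub>H\<^esub> x"
  using assms by (auto simp: commuting_graph_def doubleton_eq_iff)

lemma nodes_commuting_graph [simp]: "nodes (commuting_graph H \<Gamma>) = \<Gamma>"
  by (simp add: commuting_graph_def)

lemma complete_graph_edge_iff: "{x, y} \<in> edges K\<^bsub>m\<^esub> \<longleftrightarrow> x < m \<and> y < m \<and> x \<noteq> y"
  by (auto simp: complete_graph_def doubleton_eq_iff)

lemma nodes_complete_graph [simp]: "nodes K\<^bsub>m\<^esub> = {..<m}"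
  by (simp add: complete_graph_def)

lemma graph_copies_edge_iff:
  "{(i, x), (j, y)} \<in> edges (k \<odot>\<^sub>g G) \<longleftrightarrow> i = j \<and> i < k \<and> {x, y} \<in> edges G"
proof
  assume "{(i, x), (j, y)} \<in> edges (k \<odot>\<^sub>g G)"
  then obtain l e where e: "{(i, x), (j, y)} = Pair l ` e" "l < k" "e \<in> edges G"
    unfolding graph_copies_def by auto
  \<comment> \<open>An edge is the image of \<open>e\<close> under a single \<open>Pair l\<close>,
    so both endpoints carry the tag \<open>l\<close>.\<close>
  then have "(i, x) \<in> Pair l ` e" "(j, y) \<in> Pair l ` e" by blast+
  then have l: "i = l" "j = l" by auto
  with e(1) have "Pair l ` {x, y} = Pair l ` e" by simp
  then have "{x, y} = e" by (rule inj_image_eq_iff[THEN iffD1, rotated]) (simp add: inj_on_def)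
  with e l show "i = j \<and> i < k \<and> {x, y} \<in> edges G" by simp
next
  assume "i = j \<and> i < k \<and> {x, y} \<in> edges G"
  moreover have "{(i, x), (i, y)} = Pair i ` {x, y}" by simp
  ultimately show "{(i, x), (j, y)} \<in> edges (k \<odot>\<^sub>g G)"
    unfolding graph_copies_def by (simp del: image_insert) blast
qed

lemma nodes_graph_copies [simp]: "nodes (k \<odot>\<^sub>g G) = {..<k} \<times> nodes G"
  by (simp add: graph_copies_def)

lemma Inl_doubleton_eq_iff: "{Inl x, Inl y} = Inl ` e \<longleftrightarrow> e = {x, y}"
  using inj_image_eq_iff[OF inj_Inl, of "{x, y}" e] by auto

lemma Inr_doubleton_eq_iff: "{Inr x, Inr y} = Inr ` e \<longleftrightarrow> e = {x, y}"
  using inj_image_eq_iff[OF inj_Inr, of "{x, y}" e] by auto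

lemma Inl_Inr_doubleton:
  "{Inl x, Inl y} = Inr ` e' \<longleftrightarrow> False" "{Inr z, Inr w} = Inl ` e \<longleftrightarrow> False"
  "{Inl x, Inr z} = Inl ` e \<longleftrightarrow> False" "{Inl x, Inr z} = Inr ` e' \<longleftrightarrow> False"
  "{Inr z, Inl x} = Inl ` e \<longleftrightarrow> False" "{Inr z, Inl x} = Inr ` e' \<longleftrightarrow> False"
  by (auto dest!: equalityD1)

lemma graph_union_edge_iff [simp]:
  "{Inl x, Inl y} \<in> edges (G \<union>\<^sub>g H) \<longleftrightarrow> {x, y} \<in> edges G"
  "{Inr z, Inr w} \<in> edges (G \<union>\<^sub>g H) \<longleftrightarrow> {z, w} \<in> edges H"
  "{Inl x, Inr z} \<notin> edges (G \<union>\<^sub>g H)" "{Inr z, Inl x} \<notin> edges (G \<union>\<^sub>g H)"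
  by (auto simp: graph_union_def image_iff Inl_doubleton_eq_iff Inr_doubleton_eq_iff
      Inl_Inr_doubleton)

lemma nodes_graph_union [simp]: "nodes (G \<union>\<^sub>g H) = nodes G <+> nodes H"
  by (simp add: graph_union_def)

lemma graph_join_edge_iff [simp]:
  "{Inl x, Inl y} \<in> edges (G \<or>\<^sub>g H) \<longleftrightarrow> {x, y} \<in> edges G"
  "{Inr z, Inr w} \<in> edges (G \<or>\<^sub>g H) \<longleftrightarrow> {z, w} \<in> edges H"
  "{Inl x, Inr z} \<in> edges (G \<or>\<^sub>g H) \<longleftrightarrow> x \<in> nodes G \<and> z \<in> nodes H"
  "{Inr z, Inl x} \<in> edges (G \<or>\<^sub>g H) \<longleftrightarrow> x \<in> nodes G \<and> z \<in> nodes H"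
  by (auto simp: graph_join_def image_iff Inl_doubleton_eq_iff Inr_doubleton_eq_iff
      Inl_Inr_doubleton doubleton_eq_iff)

lemma nodes_graph_join [simp]: "nodes (G \<or>\<^sub>g H) = nodes G <+> nodes H"
  by (simp add: graph_join_def)

section \<open>Isomorphism types read off from commutation patterns\<close>

lemma commuting_graph_complete:
  assumes "finite \<Gamma>" "card \<Gamma> = m"
    and comm: "\<And>x y. x \<in> \<Gamma> \<Longrightarrow> y \<in> \<Gamma> \<Longrightarrow> x \<otimes>\<^bsub>H\<^esub> y = y \<otimes>\<^bsub>H\<^esub> x"
  shows "commuting_graph H \<Gamma> \<simeq>\<^sub>g K\<^bsub>m\<^esub>"
proof -
  obtain f where f: "bij_betw f \<Gamma> {..<m}"
    using ex_bij_betw_finite_nat[OF assms(1)] assms(2) by (auto simp: atLeast0LessThan)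
  have "{x, y} \<in> edges (commuting_graph H \<Gamma>) \<longleftrightarrow> {f x, f y} \<in> edges K\<^bsub>m\<^esub>"
    if "x \<in> \<Gamma>" "y \<in> \<Gamma>" for x y
    using that f comm[OF that] by (auto simp: commuting_graph_edge_iff complete_graph_edge_iff
        bij_betw_def inj_on_eq_iff)
  with f show ?thesis unfolding graph_iso_def by auto
qed

text \<open>When commuting means lying in a common class, each class is a clique and no edge joins
  two classes. Bijections from the classes to \<open>{..<m}\<close>, tagged with the index of the
  class, then give the isomorphism.\<close>

lemma commuting_graph_copies:
  assumes fin: "\<And>i. i < k \<Longrightarrow> finite (V i)" and card: "\<And>i. i < k \<Longrightarrow> card (V i) = m"
    and within: "\<And>i x y. i < k \<Longrightarrow> x \<in> V i \<Longrightarrow> y \<in> V i \<Longrightarrow> x \<otimes>\<^bsub>H\<^esub> y = y \<otimes>\<^bsub>H\<^esub> x"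
    and across: "\<And>i j x y. i < k \<Longrightarrow> j < k \<Longrightarrow> x \<in> V i \<Longrightarrow> y \<in> V j \<Longrightarrow>
                   x \<otimes>\<^bsub>H\<^esub> y = y \<otimes>\<^bsub>H\<^esub> x \<Longrightarrow> i = j"
  shows "commuting_graph H (\<Union>i<k. V i) \<simeq>\<^sub>g k \<odot>\<^sub>g K\<^bsub>m\<^esub>"
proof -
  have "\<exists>g. bij_betw g (V i) {..<m}" if "i < k" for i
    using ex_bij_betw_finite_nat[OF fin[OF that]] card[OF that] by (auto simp: atLeast0LessThan)
  then obtain g where g: "\<And>i. i < k \<Longrightarrow> bij_betw (g i) (V i) {..<m}" by metis
  obtain ix where ix: "\<And>x. x \<in> (\<Union>i<k. V i) \<Longrightarrow> ix x < k \<and> x \<in> V (ix x)"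
    by (metis (no_types, lifting) UN_E lessThan_iff)
  \<comment> \<open>Every element commutes with itself, so \<open>across\<close> also makes the
    classes disjoint and the chosen index unique.\<close>
  have ix_eq: "ix x = i" if "i < k" "x \<in> V i" for i x
    using across[of "ix x" i x x] ix[of x] that by auto
  define f where "f x = (ix x, g (ix x) x)" for x
  have inj: "inj_on f (\<Union>i<k. V i)"
  proof (rule inj_onI)
    fix x y assume xy: "x \<in> (\<Union>i<k. V i)" "y \<in> (\<Union>i<k. V i)" "f x = f y"
    then have "ix x = ix y" "g (ix x) x = g (ix x) y" by (auto simp: f_def)
    with ix[OF xy(1)] ix[OF xy(2)] g[of "ix x"] show "x = y" by (auto simp: bij_betw_def inj_on_def)
  qed
  have img: "f ` (\<Union>i<k. V i) = {..<k} \<times> {..<m}"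
  proof
    show "f ` (\<Union>i<k. V i) \<subseteq> {..<k} \<times> {..<m}"
      using bij_betw_apply[OF g] by (auto simp: f_def ix_eq)
    show "{..<k} \<times> {..<m} \<subseteq> f ` (\<Union>i<k. V i)"
    proof clarify
      fix i l assume il: "i < k" "l < m"
      then have "l \<in> g i ` V i" using g[of i] by (simp add: bij_betw_def)
      then obtain x where x: "x \<in> V i" "g i x = l" by blast
      have "f x = (i, l)" unfolding f_def ix_eq[OF il(1) x(1)] x(2) ..
      then show "(i, l) \<in> f ` (\<Union>i<k. V i)" using il(1) x(1) by (metis UN_I imageI lessThan_iff)
    qed
  qed
  have "{x, y} \<in> edges (commuting_graph H (\<Union>i<k. V i)) \<longleftrightarrow> {f x, f y} \<in> edges (k \<odot>\<^sub>g K\<^bsub>m\<^esub>)"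
    if x: "x \<in> (\<Union>i<k. V i)" and y: "y \<in> (\<Union>i<k. V i)" for x y
  proof -
    have "x = y \<longleftrightarrow> f x = f y" using inj x y by (auto simp: inj_on_eq_iff)
    moreover have "ix x < k" "g (ix x) x < m" "g (ix y) y < m"
      using ix[OF x] ix[OF y] bij_betw_apply[OF g] by auto
    moreover have "x \<otimes>\<^bsub>H\<^esub> y = y \<otimes>\<^bsub>H\<^esub> x \<longleftrightarrow> ix x = ix y"
      using ix[OF x] ix[OF y] within[of "ix x" x y] across[of "ix x" "ix y" x y] by auto
    ultimately show ?thesis
      unfolding commuting_graph_edge_iff[OF x y] f_def graph_copies_edge_iff
        complete_graph_edge_iff by auto
  qed
  with inj img show ?thesis unfolding graph_iso_def bij_betw_def by auto
qed

lemma bij_betw_Plus: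
  assumes f: "bij_betw f A C" and g: "bij_betw g B D" and disj: "A \<inter> B = {}"
  shows "bij_betw (\<lambda>x. if x \<in> A then Inl (f x) else Inr (g x)) (A \<union> B) (C <+> D)"
  (is "bij_betw ?h _ _")
proof -
  have "bij_betw ?h A (Inl ` C)" "bij_betw ?h B (Inr ` D)"
    using f g disj by (auto simp: bij_betw_def inj_on_def image_iff)
  then show ?thesis unfolding Plus_def by (rule bij_betw_combine) auto
qed

lemma commuting_graph_union:
  assumes iso: "commuting_graph H A \<simeq>\<^sub>g G1" "commuting_graph H B \<simeq>\<^sub>g G2"
    and disj: "A \<inter> B = {}"
    and across: "\<And>x y. x \<in> A \<Longrightarrow> y \<in> B \<Longrightarrow> x \<otimes>\<^bsub>H\<^esub> y \<noteq> y \<otimes>\<^bsub>H\<^esub> x"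
  shows "commuting_graph H (A \<union> B) \<simeq>\<^sub>g G1 \<union>\<^sub>g G2"
proof -
  obtain f g where f: "bij_betw f A (nodes G1)" and g: "bij_betw g B (nodes G2)"
    and fe: "\<And>x y. x \<in> A \<Longrightarrow> y \<in> A \<Longrightarrow> x \<noteq> y \<and> x \<otimes>\<^bsub>H\<^esub> y = y \<otimes>\<^bsub>H\<^esub> x \<longleftrightarrow> {f x, f y} \<in> edges G1"
    and ge: "\<And>x y. x \<in> B \<Longrightarrow> y \<in> B \<Longrightarrow> x \<noteq> y \<and> x \<otimes>\<^bsub>H\<^esub> y = y \<otimes>\<^bsub>H\<^esub> x \<longleftrightarrow> {g x, g y} \<in> edges G2"
    using iso unfolding graph_iso_def by (auto simp: commuting_graph_edge_iff)
  let ?h = "\<lambda>x. if x \<in> A then Inl (f x) else Inr (g x)"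
  have "{x, y} \<in> edges (commuting_graph H (A \<union> B)) \<longleftrightarrow> {?h x, ?h y} \<in> edges (G1 \<union>\<^sub>g G2)"
    if "x \<in> A \<union> B" "y \<in> A \<union> B" for x y
    using that disj fe[of x y] ge[of x y] across[of x y] across[of y x]
    by (auto simp: commuting_graph_edge_iff)
  with bij_betw_Plus[OF f g disj] show ?thesis unfolding graph_iso_def by auto
qed

lemma commuting_graph_join:
  assumes iso: "commuting_graph H A \<simeq>\<^sub>g G1" "commuting_graph H B \<simeq>\<^sub>g G2"
    and disj: "A \<inter> B = {}"
    and across: "\<And>x y. x \<in> A \<Longrightarrow> y \<in> B \<Longrightarrow> x \<otimes>\<^bsub>H\<^esub> y = y \<otimes>\<^bsub>H\<^esub> x"
  shows "commuting_graph H (A \<union> B) \<simeq>\<^sub>g G1 \<or>\<^sub>g G2"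
proof -
  obtain f g where f: "bij_betw f A (nodes G1)" and g: "bij_betw g B (nodes G2)"
    and fe: "\<And>x y. x \<in> A \<Longrightarrow> y \<in> A \<Longrightarrow> x \<noteq> y \<and> x \<otimes>\<^bsub>H\<^esub> y = y \<otimes>\<^bsub>H\<^esub> x \<longleftrightarrow> {f x, f y} \<in> edges G1"
    and ge: "\<And>x y. x \<in> B \<Longrightarrow> y \<in> B \<Longrightarrow> x \<noteq> y \<and> x \<otimes>\<^bsub>H\<^esub> y = y \<otimes>\<^bsub>H\<^esub> x \<longleftrightarrow> {g x, g y} \<in> edges G2"
    using iso unfolding graph_iso_def by (auto simp: commuting_graph_edge_iff)
  let ?h = "\<lambda>x. if x \<in> A then Inl (f x) else Inr (g x)"
  have "{x, y} \<in> edges (commuting_graph H (A \<union> B)) \<longleftrightarrow> {?h x, ?h y} \<in> edges (G1 \<or>\<^sub>g G2)"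
    if "x \<in> A \<union> B" "y \<in> A \<union> B" for x y
    using that disj fe[of x y] ge[of x y] across[of x y] across[of y x]
      bij_betw_apply[OF f] bij_betw_apply[OF g]
    by (auto simp: commuting_graph_edge_iff)
  with bij_betw_Plus[OF f g disj] show ?thesis unfolding graph_iso_def by auto
qed

section \<open>Cosets of the subgroup generated by t\<close>

locale icosahedral_relations = group +
  fixes s t
  assumes s_carrier [simp]: "s \<in> carrier G" and t_carrier [simp]: "t \<in> carrier G"
    and sts: "s \<otimes> t \<otimes> s = t [^] (4::int)"
    and tst: "t \<otimes> s \<otimes> t = s \<otimes> s"
    and sss: "s \<otimes> s \<otimes> s = t [^] (5::int)"
begin

text \<open>Opaque, so that the simplifier does not rewrite \<open>T 1\<close> to \<open>t\<close>.\<close>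

definition T :: "int \<Rightarrow> 'a" where "T k = t [^] k"

lemma T_carrier [simp]: "T k \<in> carrier G" and T_0 [simp]: "T 0 = \<one>"
  by (simp_all add: T_def)

definition u :: 'a where "u = s \<otimes> (T 3 \<otimes> s)"
definition y :: 'a where "y = u \<otimes> (T 4 \<otimes> s)"

lemma u_carrier [simp]: "u \<in> carrier G" and y_carrier [simp]: "y \<in> carrier G"
  by (simp_all add: u_def y_def)

lemma T_1: "T 1 = t" by (simp add: T_def)

lemma T_T: "T i \<otimes> T j = T (i + j)" by (simp add: T_def int_pow_mult)

lemma T_T_mult: "x \<in> carrier G \<Longrightarrow> T i \<otimes> (T j \<otimes> x) = T (i + j) \<otimes> x"
  by (simp add: T_T flip: m_assoc)

section \<open>Moving a right factor \<open>s\<close> through powers of \<open>t\<close>\<close>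

lemma s_T1_s: "s \<otimes> (T 1 \<otimes> s) = T 4" using sts by (simp add: T_1 m_assoc flip: T_def)

lemma s_s: "s \<otimes> s = T 1 \<otimes> (s \<otimes> T 1)" using tst by (simp add: T_1 m_assoc)

lemma s_s_s: "s \<otimes> (s \<otimes> s) = T 5" using sss by (simp add: m_assoc flip: T_def)

lemma s_T5: "s \<otimes> T 5 = T 5 \<otimes> s" by (simp add: m_assoc flip: s_s_s)

text \<open>Being \<open>s^3\<close>, the element \<open>T 5\<close> commutes with \<open>s\<close>.
  Up to a left factor, exponents to the right of \<open>s\<close> therefore matter only modulo
  5.\<close>

lemma s_T_add5: "s \<otimes> T (i + 5) = T 5 \<otimes> (s \<otimes> T i)"
proof -
  have "s \<otimes> T (i + 5) = s \<otimes> T 5 \<otimes> T i" by (simp add: m_assoc T_T add.commute)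
  then show ?thesis by (simp add: s_T5 m_assoc)
qed

text \<open>A left factor \<open>t\<close> makes \<open>tst = s^2\<close> applicable:
  \<open>t s t^2 s = s s t s\<close>.\<close>

lemma s_T2_s: "s \<otimes> (T 2 \<otimes> s) = T (-1) \<otimes> (s \<otimes> T 4)"
proof -
  have "T 1 \<otimes> (s \<otimes> (T 2 \<otimes> s)) = s \<otimes> s \<otimes> (T 1 \<otimes> s)"
    by (simp add: s_s m_assoc T_T_mult)
  also have "\<dots> = s \<otimes> T 4" by (simp add: m_assoc s_T1_s)
  finally have "T (-1) \<otimes> (T 1 \<otimes> (s \<otimes> (T 2 \<otimes> s))) = T (-1) \<otimes> (s \<otimes> T 4)" by simp
  then show ?thesis by (simp add: T_T_mult)
qed

text \<open>Write \<open>t^4\<close> as \<open>sts\<close> and replace both resulting squares by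
  \<open>tst\<close>; the product \<open>tst t tst\<close> contains \<open>u\<close> in the
  middle.\<close>

lemma s_T4_s: "s \<otimes> (T 4 \<otimes> s) = T 1 \<otimes> (u \<otimes> T 1)"
proof -
  have "s \<otimes> (T 4 \<otimes> s) = s \<otimes> s \<otimes> (T 1 \<otimes> (s \<otimes> s))" by (simp add: m_assoc flip: s_T1_s)
  also have "\<dots> = T 1 \<otimes> (u \<otimes> T 1)" by (simp add: s_s m_assoc T_T_mult u_def)
  finally show ?thesis .
qed

lemma u_s: "u \<otimes> s = T 1 \<otimes> (u \<otimes> T 2)"
proof -
  have "u \<otimes> s = s \<otimes> (T 4 \<otimes> s) \<otimes> T 1" by (simp add: u_def s_s m_assoc T_T_mult)
  then show ?thesis by (simp only: s_T4_s) (simp add: m_assoc T_T)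
qed

lemma u_T5: "u \<otimes> T 5 = T 5 \<otimes> u"
proof -
  have "u \<otimes> T 5 = s \<otimes> (T 3 \<otimes> (s \<otimes> T 5))" by (simp add: u_def m_assoc)
  also have "\<dots> = s \<otimes> (T 5 \<otimes> (T 3 \<otimes> s))" by (simp add: s_T5 T_T_mult)
  also have "\<dots> = s \<otimes> T 5 \<otimes> (T 3 \<otimes> s)" by (simp add: m_assoc)
  finally show ?thesis by (simp add: s_T5 u_def m_assoc)
qed

lemma u_T_add5: "u \<otimes> T (i + 5) = T 5 \<otimes> (u \<otimes> T i)"
proof -
  have "u \<otimes> T (i + 5) = u \<otimes> T 5 \<otimes> T i" by (simp add: m_assoc T_T add.commute)
  then show ?thesis by (simp add: u_T5 m_assoc)
qed

lemma u_T1_s: "u \<otimes> (T 1 \<otimes> s) = T 5 \<otimes> (s \<otimes> T 2)"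
  using s_T_add5[of 2] by (simp add: u_def m_assoc s_T1_s T_T)

lemma u_T2_s: "u \<otimes> (T 2 \<otimes> s) = T 4 \<otimes> (s \<otimes> T 3)"
proof -
  have "u \<otimes> (T 2 \<otimes> s) = s \<otimes> (T 2 \<otimes> (s \<otimes> T 4))"
    by (simp add: u_def m_assoc s_T2_s T_T_mult)
  also have "\<dots> = s \<otimes> (T 2 \<otimes> s) \<otimes> T 4" by (simp add: m_assoc)
  also have "\<dots> = T (-1) \<otimes> (s \<otimes> T (3 + 5))" 
    by (simp only: s_T2_s) (simp add: m_assoc, simp add: T_T)
  finally show ?thesis by (simp only: s_T_add5) (simp add: T_T_mult)
qed

text \<open>In \<open>y = s t^3 s t^4 s\<close>, expanding the final \<open>s t^4 s\<close> as
  \<open>t u t\<close> creates another \<open>s t^4 s\<close> at the front; expanding that one too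
  reproduces \<open>y\<close> as \<open>t y t\<close>.\<close>

lemma y_T1: "y \<otimes> T 1 = T (-1) \<otimes> y"
proof -
  have "y = s \<otimes> (T 3 \<otimes> (s \<otimes> (T 4 \<otimes> s)))" by (simp add: y_def u_def m_assoc)
  also have "\<dots> = s \<otimes> (T 4 \<otimes> (u \<otimes> T 1))" by (simp add: s_T4_s T_T_mult)
  also have "\<dots> = s \<otimes> (T 4 \<otimes> s) \<otimes> (T 3 \<otimes> (s \<otimes> T 1))" by (simp add: u_def m_assoc)
  also have "\<dots> = T 1 \<otimes> (y \<otimes> T 1)"
    by (simp only: s_T4_s) (simp add: m_assoc T_T_mult y_def)
  finally have "T (-1) \<otimes> y = T (-1) \<otimes> (T 1 \<otimes> (y \<otimes> T 1))" by simp
  then show ?thesis by (simp add: T_T_mult)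
qed

text \<open>Prepares \<open>y_s\<close>: one more factor \<open>s\<close> completes the cube
  \<open>s^3 = t^5\<close>.\<close>

lemma u_T3_s_s: "u \<otimes> (T 3 \<otimes> (s \<otimes> s)) = T (-1) \<otimes> y"
proof -
  have "u \<otimes> (T 3 \<otimes> (s \<otimes> s)) = s \<otimes> (T 3 \<otimes> (u \<otimes> s))" by (simp add: u_def m_assoc)
  also have "\<dots> = s \<otimes> (T 4 \<otimes> (u \<otimes> T 2))" by (simp add: u_s T_T_mult)
  also have "\<dots> = s \<otimes> (T 4 \<otimes> s) \<otimes> (T 3 \<otimes> (s \<otimes> T 2))" by (simp add: u_def m_assoc)
  also have "\<dots> = T 1 \<otimes> (y \<otimes> T 1 \<otimes> T 1)"
    by (simp only: s_T4_s) (simp add: m_assoc T_T_mult T_T y_def)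
  also have "\<dots> = T (-1) \<otimes> y" by (simp add: y_T1 m_assoc T_T_mult)
  finally show ?thesis .
qed

lemma y_s: "y \<otimes> s = T 6 \<otimes> (u \<otimes> T 3)"
proof -
  have "y \<otimes> s = T 1 \<otimes> (T (-1) \<otimes> y) \<otimes> s" by (simp add: T_T_mult)
  also have "\<dots> = T 1 \<otimes> (u \<otimes> T (3 + 5))"
    unfolding u_T3_s_s[symmetric] by (simp add: m_assoc s_s_s T_T)
  finally show ?thesis by (simp only: u_T_add5) (simp add: T_T_mult)
qed

text \<open>Multiply \<open>y_s\<close> by \<open>s\<close> on the right: by definition of
  \<open>y\<close>, \<open>y s s = u t^4 s^3\<close>, which is \<open>u t^9\<close>.\<close>

lemma u_T3_s: "u \<otimes> (T 3 \<otimes> s) = T (-1) \<otimes> (u \<otimes> T 4)"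
proof -
  have "T 6 \<otimes> (u \<otimes> (T 3 \<otimes> s)) = y \<otimes> s \<otimes> s" by (simp add: y_s m_assoc)
  also have "\<dots> = u \<otimes> T (4 + 5)" by (simp add: y_def m_assoc s_s_s T_T)
  finally have "T (-6) \<otimes> (T 6 \<otimes> (u \<otimes> (T 3 \<otimes> s))) = T (-6) \<otimes> (T 5 \<otimes> (u \<otimes> T 4))"
    by (simp only: u_T_add5)
  then show ?thesis by (simp add: T_T_mult)
qed

lemma y_T5: "y \<otimes> T 5 = T (-5) \<otimes> y"
proof -
  have "y \<otimes> T (1 + i) = T (-1) \<otimes> (y \<otimes> T i)" for i
  proof -
    have "y \<otimes> T (1 + i) = y \<otimes> T 1 \<otimes> T i" by (simp add: m_assoc T_T)
    then show ?thesis by (simp add: y_T1 m_assoc)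
  qed
  from this[of 0] this[of 1] this[of 2] this[of 3] this[of 4] show ?thesis
    by (simp add: T_T_mult)
qed

text \<open>\<open>y\<close> inverts \<open>t^5\<close>, yet \<open>t^5\<close> commutes with the
  factors \<open>u\<close>, \<open>t^4\<close> and \<open>s\<close> of \<open>y\<close>. Hence
  \<open>t^5\<close> is its own inverse.\<close>

lemma T_10: "T 10 = \<one>"
proof -
  have "T (-5) \<otimes> y = y \<otimes> T 5" by (simp add: y_T5)
  also have "\<dots> = u \<otimes> (T 4 \<otimes> (s \<otimes> T 5))" by (simp add: y_def m_assoc)
  also have "\<dots> = u \<otimes> (T 5 \<otimes> (T 4 \<otimes> s))" by (simp add: s_T5 T_T_mult)
  also have "\<dots> = u \<otimes> T 5 \<otimes> (T 4 \<otimes> s)" by (simp add: m_assoc)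
  also have "\<dots> = T 5 \<otimes> y" by (simp add: u_T5 y_def m_assoc)
  finally have "T (-5) = T 5" by simp
  then have "T 5 \<otimes> T (-5) = T 5 \<otimes> T 5" by simp
  then show ?thesis by (simp add: T_T)
qed

lemma T_mod10: "T k = T (k mod 10)"
proof -
  have "T (10 * (k div 10)) = T 10 [^] (k div 10)" by (simp only: T_def int_pow_pow t_carrier)
  then have "T (10 * (k div 10)) = \<one>" by (simp only: T_10 int_pow_one)
  moreover have "T k = T (10 * (k div 10)) \<otimes> T (k mod 10)" by (simp only: T_T mult_div_mod_eq)
  ultimately show ?thesis by simp
qed

text \<open>The twelve representatives correspond to the vertices of an icosahedron on which \<open>t\<close> acts
  as a rotation about a vertex.\<close>

definition cosets :: "'a set" where
  "cosets = {\<one>, y} \<union> (\<lambda>i. s \<otimes> T i) ` {0..<5} \<union> (\<lambda>i. u \<otimes> T i) ` {0..<5}"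

section \<open>Normal forms and their closure under right multiplication\<close>

definition normal_forms :: "'a set" where
  "normal_forms = (\<lambda>(k, w). T k \<otimes> w) ` ({0..<10} \<times> cosets)"

lemma cosets_I:
  "\<one> \<in> cosets" "y \<in> cosets" "s \<in> cosets" "u \<in> cosets"
  "0 \<le> i \<Longrightarrow> i < 5 \<Longrightarrow> s \<otimes> T i \<in> cosets" "0 \<le> i \<Longrightarrow> i < 5 \<Longrightarrow> u \<otimes> T i \<in> cosets"
proof -
  show *: "s \<otimes> T i \<in> cosets" "u \<otimes> T i \<in> cosets" if "0 \<le> i" "i < 5" for i
    using that by (auto simp: cosets_def)
  show "s \<in> cosets" "u \<in> cosets" using *[of 0] by simp_all
qed (simp_all add: cosets_def)

lemma cosets_carrier: "cosets \<subseteq> carrier G" by (auto simp: cosets_def)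

lemma normal_forms_carrier: "normal_forms \<subseteq> carrier G"
  using cosets_carrier by (auto simp: normal_forms_def)

lemma T_mult_normal_form: "w \<in> cosets \<Longrightarrow> T k \<otimes> w \<in> normal_forms"
  unfolding normal_forms_def by (subst T_mod10) force

lemma T_mult_normal_forms: "x \<in> normal_forms \<Longrightarrow> T k \<otimes> x \<in> normal_forms"
proof -
  assume "x \<in> normal_forms"
  then obtain j w where w: "x = T j \<otimes> w" "w \<in> cosets" by (auto simp: normal_forms_def)
  then have "T k \<otimes> x = T (k + j) \<otimes> w" using cosets_carrier by (auto simp: T_T_mult)
  then show ?thesis using w(2) by (simp add: T_mult_normal_form)
qed

lemma int_upto_5: "{0..<5} = {0, 1, 2, 3, 4 :: int}" by auto

text \<open>The action of \<open>s\<close> on the twelve cosets is the table formed by the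
  identities above, together with \<open>s t^3 s = u\<close> and \<open>u t^4 s = y\<close>, which
  hold by definition.\<close>

lemma coset_mult_s: "w \<in> cosets \<Longrightarrow> w \<otimes> s \<in> normal_forms"
proof -
  assume "w \<in> cosets"
  then consider "w = \<one>" | "w = y" | "w = s \<otimes> T 0" | "w = s \<otimes> T 1" | "w = s \<otimes> T 2"
    | "w = s \<otimes> T 3" | "w = s \<otimes> T 4" | "w = u \<otimes> T 0" | "w = u \<otimes> T 1" | "w = u \<otimes> T 2"
    | "w = u \<otimes> T 3" | "w = u \<otimes> T 4"
    unfolding cosets_def int_upto_5 by fast
  \<comment> \<open>In each case \<open>that\<close> receives the new representative and then the
    exponent of its left factor.\<close>
  then obtain k v where "v \<in> cosets" "w \<otimes> s = T k \<otimes> v"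
  proof cases
    case 1 then show ?thesis using that[of "s \<otimes> T 0" 0] by (simp add: cosets_I)
  next
    case 2 then show ?thesis using that[of "u \<otimes> T 3" 6] by (simp add: cosets_I y_s)
  next
    case 3 then show ?thesis using that[of "s \<otimes> T 1" 1] by (simp add: cosets_I s_s)
  next
    case 4 then show ?thesis using that[of "\<one>" 4] by (simp add: cosets_I m_assoc s_T1_s)
  next
    case 5 then show ?thesis using that[of "s \<otimes> T 4" "-1"]
      by (simp add: cosets_I m_assoc s_T2_s)
  next
    case 6 then show ?thesis using that[of u 0] by (simp add: cosets_I m_assoc flip: u_def)
  next
    case 7 then show ?thesis using that[of "u \<otimes> T 1" 1] by (simp add: cosets_I m_assoc s_T4_s)
  next
    case 8 then show ?thesis using that[of "u \<otimes> T 2" 1] by (simp add: cosets_I u_s)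
  next
    case 9 then show ?thesis using that[of "s \<otimes> T 2" 5] by (simp add: cosets_I m_assoc u_T1_s)
  next
    case 10 then show ?thesis using that[of "s \<otimes> T 3" 4] by (simp add: cosets_I m_assoc u_T2_s)
  next
    case 11 then show ?thesis using that[of "u \<otimes> T 4" "-1"]
      by (simp add: cosets_I m_assoc u_T3_s)
  next
    case 12 then show ?thesis using that[of y 0] by (simp add: cosets_I m_assoc flip: y_def)
  qed
  then show ?thesis by (simp add: T_mult_normal_form)
qed

text \<open>Within each family of five, \<open>t\<close> raises \<open>i\<close> by one; after
  \<open>i = 4\<close> the factor \<open>t^5\<close> moves to the left and \<open>i\<close> restarts
  at 0.\<close>

lemma coset_mult_t: "w \<in> cosets \<Longrightarrow> w \<otimes> t \<in> normal_forms"
proof -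
  assume "w \<in> cosets"
  then consider "w = \<one>" | "w = y"
    | i where "w = s \<otimes> T i" "i \<in> {0..<5}" | i where "w = u \<otimes> T i" "i \<in> {0..<5}"
    unfolding cosets_def by blast
  then obtain k v where "v \<in> cosets" "w \<otimes> T 1 = T k \<otimes> v"
  proof cases
    case 1 then show ?thesis using that[of "\<one>" 1] by (simp add: cosets_I)
  next
    case 2 then show ?thesis using that[of y "-1"] by (simp add: cosets_I y_T1)
  next
    case 3
    then have "w \<otimes> T 1 = s \<otimes> T (i + 1)" by (simp add: m_assoc T_T)
    then show ?thesis
      using that[of "s \<otimes> T (i + 1)" 0] that[of "s \<otimes> T 0" 5] 3(2) s_T_add5[of 0]
      by (cases "i = 4") (simp_all add: cosets_I)
  next
    case 4
    then have "w \<otimes> T 1 = u \<otimes> T (i + 1)" by (simp add: m_assoc T_T)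
    then show ?thesis
      using that[of "u \<otimes> T (i + 1)" 0] that[of "u \<otimes> T 0" 5] 4(2) u_T_add5[of 0]
      by (cases "i = 4") (simp_all add: cosets_I)
  qed
  then show ?thesis by (simp add: T_mult_normal_form T_1)
qed

lemma normal_forms_mult:
  assumes "x \<in> normal_forms" "g = s \<or> g = t"
  shows "x \<otimes> g \<in> normal_forms"
proof -
  obtain k w where "x = T k \<otimes> w" "w \<in> cosets" using assms(1) by (auto simp: normal_forms_def)
  moreover from this have "w \<in> carrier G" "w \<otimes> g \<in> normal_forms"
    using cosets_carrier assms(2) coset_mult_s coset_mult_t by auto
  ultimately show ?thesis using T_mult_normal_forms assms(2) by (auto simp: m_assoc)
qed

lemma one_normal_form: "\<one> \<in> normal_forms"
  using T_mult_normal_form[of "\<one>" 0] by (simp add: cosets_I)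

end

section \<open>The matrix model\<close>

text \<open>The quadruple \<open>(a, b, c, d)\<close> is the matrix with rows \<open>(a, b)\<close> and \<open>(c, d)\<close> over the field
  with five elements; entries of matrices in use are reduced to \<open>{0..4}\<close>.\<close>

type_synonym mat = "int \<times> int \<times> int \<times> int"

fun mmul :: "mat \<Rightarrow> mat \<Rightarrow> mat" where
  "mmul (a, b, c, d) (a', b', c', d') =
     ((a * a' + b * c') mod 5, (a * b' + b * d') mod 5,
      (c * a' + d * c') mod 5, (c * b' + d * d') mod 5)"

definition mone :: mat where "mone = (1, 0, 0, 1)"

text \<open>The matrices have determinant 1 and satisfy \<open>r = s t\<close> and
  \<open>r^2 = s^3 = t^5 = -1\<close> modulo 5, where 4 stands for -1.\<close>

fun mat_letter :: "bi_gen \<times> bool \<Rightarrow> mat" where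
  "mat_letter (gen_r, b) = (if b then (0, 4, 1, 0) else (0, 1, 4, 0))"
| "mat_letter (gen_s, b) = (if b then (0, 1, 4, 1) else (1, 4, 1, 0))"
| "mat_letter (gen_t, b) = (if b then (4, 4, 0, 4) else (4, 1, 0, 4))"

definition mat_word :: "bi_gen gword \<Rightarrow> mat" where
  "mat_word w = foldr (\<lambda>l. mmul (mat_letter l)) w mone"

lemma mmul_assoc: "mmul (mmul x y) z = mmul x (mmul y z)"
proof -
  have mods: "(p mod 5 * v + q mod 5 * w) mod 5 = (p * v + q * w) mod 5"
    "(v * (p mod 5) + w * (q mod 5)) mod 5 = (v * p + w * q) mod 5" for p q v w :: int
    by (rule mod_add_cong; simp only: mod_mult_left_eq mod_mult_right_eq)+
  obtain a b c d a' b' c' d' a'' b'' c'' d''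
    where "x = (a, b, c, d)" "y = (a', b', c', d')" "z = (a'', b'', c'', d'')"
    by (cases x, cases y, cases z)
  then show ?thesis
    by (simp only: mmul.simps mods distrib_left distrib_right mult.assoc add.assoc
        add.left_commute)
qed

text \<open>Multiplication by \<open>mone\<close> reduces entries modulo 5, so it fixes reduced
  matrices only. Values of \<open>mat_word\<close> are reduced, being \<open>mone\<close> or a
  product.\<close>

lemma mmul_mone_mat_word: "mmul mone (mat_word w) = mat_word w"
proof -
  have "mmul mone (mmul x y) = mmul x y" for x y
  proof -
    obtain a b c d a' b' c' d' where "x = (a, b, c, d)" "y = (a', b', c', d')"
      by (cases x, cases y)
    then show ?thesis by (simp add: mone_def)
  qed
  moreover have "mmul mone mone = mone" by (simp add: mone_def)
  ultimately show ?thesis by (cases w) (simp_all add: mat_word_def)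
qed

lemma mat_word_append: "mat_word (u @ v) = mmul (mat_word u) (mat_word v)"
proof (induction u)
  case Nil
  show ?case using mmul_mone_mat_word by (simp add: mat_word_def)
next
  case (Cons l u)
  then show ?case by (simp add: mat_word_def mmul_assoc)
qed

text \<open>Evaluation respects the relators and the cancellations, so it descends to the presented
  group.\<close>

lemma word_eq_mat_word: "word_eq bi_relations u v \<Longrightarrow> mat_word u = mat_word v"
proof (induction rule: word_eq.induct)
  case (relator u v)
  then show ?case
    by (auto simp: bi_relations_def Let_def mat_word_def mone_def)
next
  case (cancel x b)
  show ?case by (cases x; cases b) (simp_all add: mat_word_def mone_def)
qed (simp_all add: mat_word_append)

text \<open>The induced homomorphism; \<open>rho_word_class\<close> shows that the choice of the
  word does not matter.\<close>

definition rho :: "bi_gen gword set \<Rightarrow> mat" where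
  "rho A = mat_word (SOME w. w \<in> A)"

lemma rho_word_class [simp]: "rho (word_class bi_relations w) = mat_word w"
proof -
  have "w \<in> word_class bi_relations w" by (simp add: word_class_def word_eq.refl)
  then have "(SOME v. v \<in> word_class bi_relations w) \<in> word_class bi_relations w"
    by (rule someI)
  then show ?thesis by (simp add: rho_def word_class_def word_eq_mat_word)
qed

lemma carrier_BI120: "carrier BI120 = range (word_class bi_relations)"
  by (simp add: BI120_def presented_group_def)

lemma one_BI120: "\<one>\<^bsub>BI120\<^esub> = word_class bi_relations []"
  by (simp add: BI120_def presented_group_def)

lemma mult_BI120 [simp]:
  "word_class bi_relations u \<cdot> word_class bi_relations v = word_class bi_relations (u @ v)"
  by (simp add: BI120_def mult_word_class)

lemma word_class_carrier [simp]: "word_class bi_relations w \<in> carrier BI120"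
  by (simp add: carrier_BI120)

interpretation BI120: group BI120
  unfolding BI120_def by (rule group_presented_group)

lemma rho_mult: "x \<in> carrier BI120 \<Longrightarrow> y \<in> carrier BI120 \<Longrightarrow> rho (x \<cdot> y) = mmul (rho x) (rho y)"
  by (auto simp: carrier_BI120 mat_word_append)

lemma bi_elem_carrier [simp]: "bi_elem g \<in> carrier BI120"
  by (simp add: bi_elem_def)

lemma bi_elem_mult [simp]:
  "bi_elem g \<cdot> word_class bi_relations w = word_class bi_relations ((g, True) # w)"
  "word_class bi_relations w \<cdot> bi_elem g = word_class bi_relations (w @ [(g, True)])"
  by (simp_all add: bi_elem_def)

lemma bi_relation_1: "\<r> \<cdot> \<r> = \<r> \<cdot> (\<s> \<cdot> \<t>)"
  and bi_relation_2: "\<s> \<cdot> \<s> \<cdot> \<s> = \<r> \<cdot> (\<s> \<cdot> \<t>)"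
  and bi_relation_3: "\<t> \<cdot> \<t> \<cdot> \<t> \<cdot> \<t> \<cdot> \<t> = \<r> \<cdot> (\<s> \<cdot> \<t>)"
  by (simp_all add: bi_elem_def word_class_eq_iff)
    (rule word_eq.relator, simp add: bi_relations_def Let_def)+

lemma bi_r_eq: "\<r> = \<s> \<cdot> \<t>"
  using bi_relation_1 by simp

interpretation BI120: icosahedral_relations BI120 \<s> \<t>
proof
  have pow: "\<t> \<up> 4 = \<t> \<cdot> \<t> \<cdot> \<t> \<cdot> \<t>" "\<t> \<up> 5 = \<t> \<cdot> \<t> \<cdot> \<t> \<cdot> \<t> \<cdot> \<t>"
    using int_pow_int[of BI120 \<t> 4] int_pow_int[of BI120 \<t> 5] by (simp_all add: numeral_eq_Suc)
  show "\<s> \<cdot> \<s> \<cdot> \<s> = \<t> \<up> 5" by (simp add: pow bi_relation_2 bi_relation_3)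
  \<comment> \<open>With \<open>r = s t\<close> substituted, cancelling \<open>t\<close> on the
    right of \<open>t^5 = r s t\<close> and, below, \<open>s\<close> on the left of
    \<open>s^3 = r s t\<close> leaves the two remaining identities.\<close>
  have "\<s> \<cdot> \<t> \<cdot> \<s> \<cdot> \<t> = \<t> \<up> 4 \<cdot> \<t>"
    using bi_relation_3 unfolding bi_r_eq pow by (simp add: BI120.m_assoc)
  then show "\<s> \<cdot> \<t> \<cdot> \<s> = \<t> \<up> 4" by simp
  have "\<s> \<cdot> (\<t> \<cdot> \<s> \<cdot> \<t>) = \<s> \<cdot> (\<s> \<cdot> \<s>)"
    using bi_relation_2 unfolding bi_r_eq by (simp add: BI120.m_assoc)
  then show "\<t> \<cdot> \<s> \<cdot> \<t> = \<s> \<cdot> \<s>" by simp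
qed simp_all

text \<open>The normal forms contain the identity and are closed under right multiplication by every
  letter, so induction on words reaches the whole group. For inverse letters: right multiplication
  by a generator maps this finite set injectively into itself and hence permutes it.\<close>

lemma carrier_subset_normal_forms: "carrier BI120 \<subseteq> BI120.normal_forms"
proof -
  have gen: "x \<cdot> bi_elem g \<in> BI120.normal_forms" if "x \<in> BI120.normal_forms" for x g
  proof (cases g)
    case gen_r
    have "x \<in> carrier BI120" using that BI120.normal_forms_carrier by blast
    then have "x \<cdot> \<r> = x \<cdot> \<s> \<cdot> \<t>" by (simp add: bi_r_eq BI120.m_assoc)
    then show ?thesis using that gen_r by (simp add: BI120.normal_forms_mult)
  qed (use that BI120.normal_forms_mult in auto)
  have fin: "finite BI120.normal_forms"
    by (simp add: BI120.normal_forms_def BI120.cosets_def)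
  have letter: "x \<cdot> word_class bi_relations [(g, b)] \<in> BI120.normal_forms"
    if x: "x \<in> BI120.normal_forms" for x g b
  proof (cases b)
    case False
    let ?f = "\<lambda>x. x \<cdot> bi_elem g"
    have "inj_on ?f BI120.normal_forms"
      using BI120.normal_forms_carrier by (intro inj_onI) (simp add: subset_iff)
    then have "?f ` BI120.normal_forms = BI120.normal_forms"
      using gen by (intro endo_inj_surj fin) auto
    \<comment> \<open>This preimage \<open>y\<close> is the product of \<open>x\<close> with the
      inverse letter.\<close>
    then obtain y where y: "y \<in> BI120.normal_forms" "x = y \<cdot> bi_elem g" using x by blast
    then obtain w where w: "y = word_class bi_relations w"
      using BI120.normal_forms_carrier carrier_BI120 by auto
    have "word_eq bi_relations (w @ [(g, True), (g, \<not> True)] @ []) (w @ [] @ [])"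
      by (intro word_eq.cong word_eq.cancel)
    then show ?thesis using y w False by (simp add: bi_elem_def word_class_eq_iff)
        (simp flip: word_class_eq_iff)
  qed (use gen[OF x] in \<open>simp add: bi_elem_def\<close>)
  have "word_class bi_relations w \<in> BI120.normal_forms" for w
  proof (induction w rule: rev_induct)
    case Nil
    show ?case using BI120.one_normal_form by (simp add: one_BI120)
  next
    case (snoc l w)
    then show ?case using letter[of _ "fst l" "snd l"] by fastforce
  qed
  then show ?thesis by (auto simp: carrier_BI120)
qed

section \<open>Faithfulness of the matrix model\<close>

definition coset_words :: "bi_gen gword list" where
  "coset_words = (let s = (gen_s, True); t = (gen_t, True) in
     [[], [s, t, t, t, s, t, t, t, t, s]] @
     map (\<lambda>i. s # replicate i t) [0..<5] @
     map (\<lambda>i. [s, t, t, t, s] @ replicate i t) [0..<5])"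

definition normal_words :: "bi_gen gword list" where
  "normal_words = concat (map (\<lambda>w. map (\<lambda>k. replicate k (gen_t, True) @ w) [0..<10]) coset_words)"

lemma T_word: "BI120.T (int n) = word_class bi_relations (replicate n (gen_t, True))"
proof (induction n)
  case 0
  show ?case by (simp add: one_BI120)
next
  case (Suc n)
  have "BI120.T (int (Suc n)) = BI120.T 1 \<cdot> BI120.T (int n)" by (simp add: BI120.T_T)
  then show ?case by (simp add: BI120.T_1 Suc.IH)
qed

lemma normal_forms_words: "BI120.normal_forms \<subseteq> word_class bi_relations ` set normal_words"
proof -
  have T: "BI120.T k = word_class bi_relations (replicate (nat k) (gen_t, True))" if "0 \<le> k" for k
    using T_word[of "nat k"] that by simp
  have "BI120.cosets \<subseteq> word_class bi_relations ` set coset_words"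
  proof
    fix w assume "w \<in> BI120.cosets"
    then consider "w = \<one>\<^bsub>BI120\<^esub>" | "w = BI120.y"
      | i where "w = \<s> \<cdot> BI120.T i" "i \<in> {0..<5}" | i where "w = BI120.u \<cdot> BI120.T i" "i \<in> {0..<5}"
      unfolding BI120.cosets_def by blast
    then show "w \<in> word_class bi_relations ` set coset_words"
    proof cases
      case 1
      then show ?thesis by (simp add: one_BI120 coset_words_def Let_def)
    next
      case 2
      then show ?thesis
        by (simp add: BI120.y_def BI120.u_def T coset_words_def Let_def numeral_eq_Suc)
    next
      case (3 i)
      then have "w = word_class bi_relations ((gen_s, True) # replicate (nat i) (gen_t, True))"
        "nat i \<in> set [0..<5]"
        by (auto simp: T)
      then show ?thesis by (force simp: coset_words_def Let_def simp del: upt_rec_numeral)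
    next
      case (4 i)
      then have "w = word_class bi_relations ([(gen_s, True), (gen_t, True), (gen_t, True),
          (gen_t, True), (gen_s, True)] @ replicate (nat i) (gen_t, True))"
        "nat i \<in> set [0..<5]"
        by (auto simp: T BI120.u_def numeral_eq_Suc)
      then show ?thesis by (force simp: coset_words_def Let_def simp del: upt_rec_numeral)
    qed
  qed
  then have "x \<in> word_class bi_relations ` set normal_words"
    if x: "x = BI120.T k \<cdot> w" "k \<in> {0..<10}" and w: "w \<in> BI120.cosets" for x k w
  proof -
    obtain v where "w = word_class bi_relations v" "v \<in> set coset_words"
      using \<open>BI120.cosets \<subseteq> _\<close> w by blast
    moreover from this have "x = word_class bi_relations (replicate (nat k) (gen_t, True) @ v)"
      "nat k \<in> set [0..<10]" using x by (auto simp: T)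
    ultimately show ?thesis
      by (auto simp: normal_words_def simp del: upt_rec_numeral intro!: imageI)
  qed
  then show ?thesis by (auto simp: BI120.normal_forms_def)
qed

text \<open>The key computation: these words cover the group, so \<open>rho\<close> is injective and
  equations between group elements can be tested on matrices.\<close>

lemma distinct_mat_normal_words: "distinct (map mat_word normal_words)"
  by code_simp

lemma length_normal_words: "length normal_words = 120"
  by code_simp

lemma carrier_BI120_words: "carrier BI120 = word_class bi_relations ` set normal_words"
  using carrier_subset_normal_forms normal_forms_words by (auto simp: carrier_BI120)

lemma inj_on_rho: "inj_on rho (carrier BI120)"
  using distinct_mat_normal_words unfolding carrier_BI120_words
  by (auto simp: inj_on_def distinct_map)

lemma finite_BI120: "finite (carrier BI120)" and card_BI120: "card (carrier BI120) \<le> 120"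
  using card_image_le[of "set normal_words" "word_class bi_relations"]
    card_length[of normal_words] length_normal_words
  by (auto simp: carrier_BI120_words)

lemma rho_commute_iff:
  assumes "x \<in> carrier BI120" "y \<in> carrier BI120"
  shows "x \<cdot> y = y \<cdot> x \<longleftrightarrow> mmul (rho x) (rho y) = mmul (rho y) (rho x)"
proof -
  have "x \<cdot> y = y \<cdot> x \<longleftrightarrow> rho (x \<cdot> y) = rho (y \<cdot> x)"
    using assms by (simp add: inj_on_eq_iff[OF inj_on_rho])
  then show ?thesis using assms by (simp add: rho_mult)
qed

section \<open>Commuting matrices\<close>

text \<open>Up to sign, the entries of the commutator \<open>xy - yx\<close> are the 2 by 2 minors
  of the vectors \<open>(a - d, b, c)\<close> and \<open>(a' - d', b', c')\<close>.\<close>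

lemma mmul_commute_iff:
  "mmul (a, b, c, d) (a', b', c', d') = mmul (a', b', c', d') (a, b, c, d) \<longleftrightarrow>
     5 dvd (a - d) * b' - (a' - d') * b \<and> 5 dvd (a - d) * c' - (a' - d') * c \<and>
     5 dvd b * c' - b' * c"
  (is "_ = _ \<longleftrightarrow> ?P \<and> ?Q \<and> ?R")
proof -
  have "(a * b' + b * d') mod 5 = (a' * b + b' * d) mod 5 \<longleftrightarrow> ?P"
    by (simp add: mod_eq_dvd_iff algebra_simps)
  \<comment> \<open>The lower row of the commutator carries the minors with the opposite
    sign.\<close>
  moreover have "(c * a' + d * c') mod 5 = (c' * a + d' * c) mod 5 \<longleftrightarrow> ?Q"
    using dvd_minus_iff[of 5 "c * a' + d * c' - (c' * a + d' * c)"]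
    by (simp add: mod_eq_dvd_iff algebra_simps)
  moreover have "(a * a' + b * c') mod 5 = (a' * a + b' * c) mod 5 \<longleftrightarrow> ?R"
    by (simp add: mod_eq_dvd_iff algebra_simps)
  moreover have "(c * b' + d * d') mod 5 = (c' * b + d' * d) mod 5 \<longleftrightarrow> ?R"
    using dvd_minus_iff[of 5 "c * b' + d * d' - (c' * b + d' * d)"]
    by (simp add: mod_eq_dvd_iff algebra_simps)
  ultimately show ?thesis by auto
qed

text \<open>\<open>x\<close> times each minor is a combination of minors that vanish modulo
  \<open>p\<close>, and \<open>x\<close> cancels because \<open>p\<close> is prime. In terms of
  vectors: two vectors proportional to a third one with nonzero first coordinate are proportional to
  each other.\<close>

lemma cross_product_dvd_trans:
  fixes p :: int
  assumes "prime p" "\<not> p dvd x"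
    and "p dvd x * y' - x' * y" "p dvd x * z' - x' * z"
    and "p dvd x * y'' - x'' * y" "p dvd x * z'' - x'' * z"
  shows "p dvd x' * y'' - x'' * y'" "p dvd x' * z'' - x'' * z'" "p dvd y' * z'' - y'' * z'"
proof -
  have cancel: "p dvd e" if "p dvd x * e" for e
    using that assms(1,2) prime_dvd_mult_iff by blast
  have xy: "p dvd x' * y'' - x'' * y'" if "p dvd x * y' - x' * y" "p dvd x * y'' - x'' * y" for y y' y''
  proof (rule cancel)
    have "x * (x' * y'' - x'' * y') = x' * (x * y'' - x'' * y) - x'' * (x * y' - x' * y)"
      by (simp add: algebra_simps)
    then show "p dvd x * (x' * y'' - x'' * y')" using that by simp
  qed
  show "p dvd x' * y'' - x'' * y'" "p dvd x' * z'' - x'' * z'" using xy assms by blast+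
  show "p dvd y' * z'' - y'' * z'"
  proof (rule cancel)
    \<comment> \<open>Besides the given minors, this combination uses the minor in \<open>x\<close>
      and \<open>z\<close> just obtained.\<close>
    have "x * (y' * z'' - y'' * z') = z'' * (x * y' - x' * y) - z' * (x * y'' - x'' * y)
        + y * (x' * z'' - x'' * z')"
      by (simp add: algebra_simps)
    then show "p dvd x * (y' * z'' - y'' * z')"
      using assms \<open>p dvd x' * z'' - x'' * z'\<close> by simp
  qed
qed

lemma cross_product_dvd_swap: "(p::int) dvd x * y - z * w \<longleftrightarrow> p dvd w * z - y * x"
  using dvd_minus_iff[of p "x * y - z * w"] by (simp add: mult.commute)

fun noncentral :: "mat \<Rightarrow> bool" where
  "noncentral (a, b, c, d) \<longleftrightarrow> a mod 5 \<noteq> d mod 5 \<or> b mod 5 \<noteq> 0 \<or> c mod 5 \<noteq> 0"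

text \<open>Commuting is transitive through a noncentral matrix because it means that the vectors
  \<open>(a - d, b, c)\<close> are proportional, and noncentral matrices have a nonzero such vector.\<close>

lemma mmul_commute_trans:
  assumes "noncentral x" "mmul x y = mmul y x" "mmul x z = mmul z x"
  shows "mmul y z = mmul z y"
proof -
  obtain a b c d a' b' c' d' a'' b'' c'' d''
    where xyz: "x = (a, b, c, d)" "y = (a', b', c', d')" "z = (a'', b'', c'', d'')"
    by (metis surj_pair)
  have prime: "prime (5::int)" by simp
  note c1 = assms(2)[unfolded xyz mmul_commute_iff] and c2 = assms(3)[unfolded xyz mmul_commute_iff]
  have "\<not> 5 dvd a - d \<or> \<not> 5 dvd b \<or> \<not> 5 dvd c"
    using assms(1) unfolding xyz by (auto simp: mod_eq_dvd_iff mod_eq_0_iff_dvd)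
  \<comment> \<open>In each case the coordinate that is nonzero modulo 5 is put first; this changes
    the minors only in order and sign.\<close>
  then show ?thesis unfolding xyz mmul_commute_iff
  proof (elim disjE)
    assume *: "\<not> 5 dvd a - d"
    show "5 dvd (a' - d') * b'' - (a'' - d'') * b' \<and> 5 dvd (a' - d') * c'' - (a'' - d'') * c' \<and>
       5 dvd b' * c'' - b'' * c'"
      using cross_product_dvd_trans[OF prime *, of b' "a' - d'" b c' c b'' "a'' - d''" c''] c1 c2
      by blast
  next
    assume *: "\<not> 5 dvd b"
    show "5 dvd (a' - d') * b'' - (a'' - d'') * b' \<and> 5 dvd (a' - d') * c'' - (a'' - d'') * c' \<and>
       5 dvd b' * c'' - b'' * c'"
      using cross_product_dvd_trans[OF prime *, of "a' - d'" b' "a - d" c' c "a'' - d''" b'' c''] c1 c2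
      by (metis cross_product_dvd_swap mult.commute)
  next
    assume *: "\<not> 5 dvd c"
    show "5 dvd (a' - d') * b'' - (a'' - d'') * b' \<and> 5 dvd (a' - d') * c'' - (a'' - d'') * c' \<and>
       5 dvd b' * c'' - b'' * c'"
      using cross_product_dvd_trans[OF prime *, of "a' - d'" c' "a - d" b' b "a'' - d''" c'' b''] c1 c2
      by (metis cross_product_dvd_swap mult.commute)
  qed
qed

section \<open>The sets of the partition\<close>

definition B_mats :: "mat list list" where
  "B_mats = [
     [(1, 0, 0, 1), (4, 0, 0, 4)],
     [(0, 4, 1, 0), (0, 1, 4, 0)],
     [(1, 3, 1, 4), (4, 2, 4, 1)],
     [(4, 1, 3, 1), (1, 4, 2, 4)],
     [(3, 2, 0, 2), (2, 3, 0, 3)],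
     [(3, 0, 0, 2), (2, 0, 0, 3)],
     [(0, 2, 2, 0), (0, 3, 3, 0)],
     [(3, 4, 0, 2), (2, 1, 0, 3)],
     [(3, 3, 0, 2), (2, 2, 0, 3)],
     [(2, 0, 2, 3), (3, 0, 3, 2)],
     [(2, 0, 3, 3), (3, 0, 2, 2)],
     [(2, 0, 4, 3), (3, 0, 1, 2)],
     [(2, 4, 0, 3), (3, 1, 0, 2)],
     [(2, 0, 1, 3), (3, 0, 4, 2)],
     [(1, 1, 3, 4), (4, 4, 2, 1)],
     [(1, 2, 4, 4), (4, 3, 1, 1)]]"

definition C_mats :: "mat list list" where
  "C_mats = [
     [(0, 1, 4, 1), (1, 4, 1, 0), (0, 4, 1, 4), (4, 1, 4, 0)],
     [(0, 1, 4, 4), (0, 4, 1, 1), (4, 4, 1, 0), (1, 1, 4, 0)],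
     [(1, 2, 1, 3), (2, 2, 1, 4), (4, 3, 4, 2), (3, 3, 4, 1)],
     [(2, 4, 2, 2), (2, 1, 3, 2), (3, 4, 2, 3), (3, 1, 3, 3)],
     [(0, 2, 2, 1), (1, 3, 3, 0), (4, 2, 2, 0), (0, 3, 3, 4)],
     [(4, 2, 1, 2), (1, 3, 4, 3), (2, 3, 4, 4), (3, 2, 1, 1)],
     [(0, 3, 3, 1), (1, 2, 2, 0), (4, 3, 3, 0), (0, 2, 2, 4)],
     [(4, 4, 3, 2), (1, 1, 2, 3), (3, 4, 3, 1), (2, 1, 2, 4)],
     [(3, 3, 1, 3), (3, 2, 4, 3), (2, 2, 4, 2), (2, 3, 1, 2)],
     [(3, 1, 2, 1), (4, 1, 2, 2), (1, 4, 3, 3), (2, 4, 3, 4)]]"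

definition D_mats :: "mat list list" where
  "D_mats = [
     [(4, 4, 0, 4), (4, 1, 0, 4), (1, 4, 0, 1), (1, 1, 0, 1), (1, 3, 0, 1), (1, 2, 0, 1),
      (4, 3, 0, 4), (4, 2, 0, 4)],
     [(1, 0, 1, 1), (1, 0, 4, 1), (4, 0, 4, 4), (4, 0, 1, 4), (4, 0, 2, 4), (1, 0, 3, 1),
      (1, 0, 2, 1), (4, 0, 3, 4)],
     [(0, 1, 4, 2), (0, 4, 1, 3), (3, 1, 4, 0), (2, 4, 1, 0), (3, 3, 2, 4), (4, 2, 3, 3),
      (1, 3, 2, 2), (2, 2, 3, 1)],
     [(3, 4, 4, 4), (1, 4, 4, 2), (4, 1, 1, 3), (2, 1, 1, 1), (3, 3, 3, 0), (2, 2, 2, 0),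
      (0, 2, 2, 3), (0, 3, 3, 2)],
     [(0, 1, 4, 3), (0, 4, 1, 2), (2, 1, 4, 0), (3, 4, 1, 0), (1, 2, 3, 2), (4, 3, 2, 3),
      (3, 2, 3, 4), (2, 3, 2, 1)],
     [(4, 4, 4, 3), (1, 1, 1, 2), (3, 1, 1, 4), (2, 4, 4, 1), (3, 2, 2, 0), (2, 3, 3, 0),
      (0, 3, 3, 3), (0, 2, 2, 2)]]"

text \<open>Index 0 is the centre, 1 to 15 are the remaining pairs, 16 to 25 the sets of four and 26
  to 31 the sets of eight.\<close>

definition all_mats :: "mat list list" where
  "all_mats = B_mats @ C_mats @ D_mats"

definition all_sets :: "bi_gen gword set set list" where
  "all_sets = B_sets @ C_sets @ D_sets"

lemma inv_bi_elem: "bi_elem g \<up> - 1 = word_class bi_relations [(g, False)]"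
proof -
  have "word_eq bi_relations [(g, False), (g, \<not> False)] []" by (rule word_eq.cancel)
  then have "word_class bi_relations [(g, False)] \<cdot> bi_elem g = \<one>\<^bsub>BI120\<^esub>"
    by (simp add: bi_elem_def one_BI120 word_class_eq_iff)
  then have "inv\<^bsub>BI120\<^esub> (bi_elem g) = word_class bi_relations [(g, False)]"
    by (intro BI120.inv_equality) simp_all
  then show ?thesis by (simp add: BI120.int_pow_neg)
qed

lemma word_class_power_2: "word_class bi_relations w \<up> 2 = word_class bi_relations (w @ w)"
proof -
  have "word_class bi_relations w \<up> 2 = word_class bi_relations w \<up> 1 \<cdot> word_class bi_relations w \<up> 1"
    by (subst BI120.int_pow_mult[symmetric]) simp_all
  then show ?thesis by simp
qed

lemma inv_bi_elem_2: "bi_elem g \<up> - 2 = word_class bi_relations [(g, False), (g, False)]"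
proof -
  have "bi_elem g \<up> - 2 = bi_elem g \<up> - 1 \<cdot> bi_elem g \<up> - 1"
    by (subst BI120.int_pow_mult[symmetric]) simp_all
  then show ?thesis by (simp add: inv_bi_elem)
qed

lemmas bi_words = one_BI120 inv_bi_elem inv_bi_elem_2 bi_elem_def[of gen_r] bi_elem_def[of gen_s]
  bi_elem_def[of gen_t] word_class_power_2

text \<open>A direct evaluation, as for the other two families: inverse powers are rewritten first,
  while the generators still appear as \<open>bi_elem\<close>; then every element becomes one word
  and the word a matrix.\<close>

lemma rho_B_sets: "map (image rho) B_sets = map set B_mats"
  by (simp add: B_sets_def B_mats_def inv_bi_elem inv_bi_elem_2)
    (simp add: bi_words mat_word_def mone_def)

lemma rho_C_sets: "map (image rho) C_sets = map set C_mats"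
  by (simp add: C_sets_def C_mats_def inv_bi_elem inv_bi_elem_2)
    (simp add: bi_words mat_word_def mone_def)

lemma rho_D_sets: "map (image rho) D_sets = map set D_mats"
  by (simp add: D_sets_def D_mats_def inv_bi_elem inv_bi_elem_2)
    (simp add: bi_words mat_word_def mone_def)

lemma length_sets: "length B_sets = 16" "length C_sets = 10" "length D_sets = 6"
  by (simp_all add: B_sets_def C_sets_def D_sets_def)

lemma length_mats: "length B_mats = 16" "length C_mats = 10" "length D_mats = 6"
  by (simp_all add: B_mats_def C_mats_def D_mats_def)

lemma sets_carrier: "A \<in> set all_sets \<Longrightarrow> A \<subseteq> carrier BI120"
  by (auto simp: all_sets_def B_sets_def C_sets_def D_sets_def)

section \<open>Finite checks on the 120 matrices\<close>

lemma distinct_mats: "distinct (concat all_mats)"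
  by code_simp

lemma length_concat_mats: "length (concat all_mats) = 120"
  by code_simp

text \<open>Comparing with the first matrix of each list suffices: outside the centre, transitivity
  extends this to all pairs in a list.\<close>

lemma mats_commute: "list_all (\<lambda>A. list_all (\<lambda>x. mmul (hd A) x = mmul x (hd A)) A) all_mats"
  by code_simp

text \<open>The tail drops the centre. First matrices suffice, since by transitivity a commuting
  pair from two lists would make their first matrices commute.\<close>

lemma mats_not_commute:
  "sorted_wrt (\<lambda>A B. mmul (hd A) (hd B) \<noteq> mmul (hd B) (hd A)) (tl all_mats)"
  by code_simp

lemma mats_noncentral: "list_all (list_all noncentral) (tl all_mats)"
  by code_simp

lemma mats_central: "list_all (\<lambda>x. list_all (\<lambda>y. mmul x y = mmul y x) (concat all_mats)) (hd all_mats)"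
  by code_simp

lemma mats_nonempty: "[] \<notin> set all_mats" by code_simp

lemma length_all: "length all_sets = 32" "length all_mats = 32"
  by (simp_all add: all_sets_def all_mats_def length_sets length_mats)

section \<open>Transfer from matrices to the group\<close>

lemma rho_all_sets: "i < 32 \<Longrightarrow> rho ` (all_sets ! i) = set (all_mats ! i)"
proof -
  assume "i < 32"
  have "map (image rho) all_sets = map set all_mats"
    by (simp add: all_sets_def all_mats_def rho_B_sets rho_C_sets rho_D_sets)
  then have "map (image rho) all_sets ! i = map set all_mats ! i" by simp
  with \<open>i < 32\<close> show ?thesis by (simp add: length_all)
qed

lemma set_all_mats: "set all_mats = (!) all_mats ` {..<32}"
  by (force simp: set_conv_nth length_all)

lemma nth_all_sets_carrier: "i < 32 \<Longrightarrow> all_sets ! i \<subseteq> carrier BI120"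
  by (simp add: sets_carrier length_all)

lemma finite_all_sets: "i < 32 \<Longrightarrow> finite (all_sets ! i)"
  using nth_all_sets_carrier finite_BI120 finite_subset by blast

lemma card_all_sets: "i < 32 \<Longrightarrow> card (all_sets ! i) = length (all_mats ! i)"
proof -
  assume i: "i < 32"
  have "card (all_sets ! i) = card (rho ` (all_sets ! i))"
    using inj_on_subset[OF inj_on_rho nth_all_sets_carrier[OF i]] by (simp add: card_image)
  also have "\<dots> = length (all_mats ! i)"
    using distinct_mats i by (simp add: rho_all_sets distinct_card distinct_concat_iff length_all)
  finally show ?thesis .
qed

text \<open>By counting: the sets have 120 distinct matrices as images, and the group has at most
  120 elements.\<close>

lemma Union_all_sets: "(\<Union>i<32. all_sets ! i) = carrier BI120" (is "?U = _")
proof (rule card_seteq[OF finite_BI120])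
  show sub: "?U \<subseteq> carrier BI120" using nth_all_sets_carrier by blast
  have "rho ` ?U = (\<Union>i<32. set (all_mats ! i))" by (simp add: image_UN rho_all_sets)
  also have "\<dots> = set (concat all_mats)" by (simp add: set_all_mats)
  finally have "card (rho ` ?U) = 120"
    using distinct_card[OF distinct_mats] length_concat_mats by simp
  moreover have "card (rho ` ?U) = card ?U"
    using inj_on_subset[OF inj_on_rho sub] by (rule card_image)
  ultimately show "card (carrier BI120) \<le> card ?U" using card_BI120 by simp
qed

lemma nth_all_mats_tl: "0 < i \<Longrightarrow> i < 32 \<Longrightarrow> all_mats ! i = tl all_mats ! (i - 1) \<and> i - 1 < length (tl all_mats)"
  by (simp add: nth_tl length_all)

lemma hd_all_mats: "i < 32 \<Longrightarrow> hd (all_mats ! i) \<in> set (all_mats ! i)"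
  using mats_nonempty by (metis hd_in_set length_all(2) nth_mem)

lemma all_mats_commute_hd:
  "i < 32 \<Longrightarrow> x \<in> set (all_mats ! i) \<Longrightarrow> mmul (hd (all_mats ! i)) x = mmul x (hd (all_mats ! i))"
  using mats_commute unfolding list_all_iff set_all_mats by blast

lemma all_mats_noncentral:
  assumes "0 < i" "i < 32" "x \<in> set (all_mats ! i)"
  shows "noncentral x"
proof -
  have "all_mats ! i \<in> set (tl all_mats)" using nth_all_mats_tl[OF assms(1,2)] by (metis nth_mem)
  then show ?thesis using mats_noncentral assms(3) unfolding list_all_iff by blast
qed

lemma all_mats_central:
  assumes "i < 32" "x \<in> set (all_mats ! 0)" "y \<in> set (all_mats ! i)"
  shows "mmul x y = mmul y x"
proof -
  have "hd all_mats = all_mats ! 0" using length_all(2) by (intro hd_conv_nth) auto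
  then have "\<forall>x\<in>set (all_mats ! 0). \<forall>y\<in>set (concat all_mats). mmul x y = mmul y x"
    using mats_central by (simp only: list_all_iff)
  moreover have "y \<in> set (concat all_mats)" using assms by (auto simp: set_all_mats)
  ultimately show ?thesis using assms(2) by blast
qed

text \<open>Transitivity through \<open>x\<close> and then through \<open>y\<close> passes from the
  given pair to the heads of the two lists, where \<open>mats_not_commute\<close> decides.
  Conversely, the head of a common list is noncentral and commutes with both matrices.\<close>

lemma all_mats_commute_iff:
  assumes i: "0 < i" "i < 32" and j: "0 < j" "j < 32"
    and x: "x \<in> set (all_mats ! i)" and y: "y \<in> set (all_mats ! j)"
  shows "mmul x y = mmul y x \<longleftrightarrow> i = j"
proof
  let ?h = "\<lambda>i. hd (all_mats ! i)"
  assume "mmul x y = mmul y x"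
  then have "mmul y (?h i) = mmul (?h i) y"
    by (rule mmul_commute_trans[OF all_mats_noncentral[OF i x]])
      (rule all_mats_commute_hd[OF i(2) x, symmetric])
  then have hij: "mmul (?h i) (?h j) = mmul (?h j) (?h i)"
    by (rule mmul_commute_trans[OF all_mats_noncentral[OF j y]])
      (rule all_mats_commute_hd[OF j(2) y, symmetric])
  have neq: "mmul (?h k) (?h l) \<noteq> mmul (?h l) (?h k)" if "0 < k" "k < l" "l < 32" for k l
  proof -
    \<comment> \<open>\<open>mats_not_commute\<close> speaks of the tail, so its indices are smaller
      by one.\<close>
    have "k - 1 < l - 1" "k < 32" "0 < l" using that by simp_all
    with sorted_wrt_nth_less[OF mats_not_commute, of "k - 1" "l - 1"] nth_all_mats_tl[of k]
      nth_all_mats_tl[of l] that show ?thesis by metis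
  qed
  show "i = j"
    using neq[OF i(1) _ j(2)] neq[OF j(1) _ i(2)] hij hij[symmetric] by (meson nat_neq_iff)
next
  assume "i = j"
  with y have y': "y \<in> set (all_mats ! i)" by simp
  show "mmul x y = mmul y x"
    by (rule mmul_commute_trans[OF all_mats_noncentral[OF i hd_all_mats[OF i(2)]]])
      (rule all_mats_commute_hd[OF i(2)], rule x y')+
qed

lemma all_sets_rho:
  "i < 32 \<Longrightarrow> x \<in> all_sets ! i \<Longrightarrow> x \<in> carrier BI120"
  "i < 32 \<Longrightarrow> x \<in> all_sets ! i \<Longrightarrow> rho x \<in> set (all_mats ! i)"
  using nth_all_sets_carrier rho_all_sets by blast+

lemma all_sets_central:
  assumes "i < 32" "x \<in> all_sets ! 0" "y \<in> all_sets ! i"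
  shows "x \<cdot> y = y \<cdot> x"
proof -
  have "x \<in> carrier BI120" "rho x \<in> set (all_mats ! 0)" using all_sets_rho[of 0 x] assms(2) by simp_all
  then show ?thesis
    using all_mats_central[of i "rho x" "rho y"] all_sets_rho[OF assms(1,3)] assms(1)
    by (simp add: rho_commute_iff)
qed

lemma all_sets_commute_iff:
  assumes "0 < i" "i < 32" "0 < j" "j < 32" "x \<in> all_sets ! i" "y \<in> all_sets ! j"
  shows "x \<cdot> y = y \<cdot> x \<longleftrightarrow> i = j"
  using assms all_mats_commute_iff[of i j "rho x" "rho y"] all_sets_rho
  by (simp add: rho_commute_iff)

lemma all_sets_disjoint:
  assumes "0 < i" "i < 32"
  shows "all_sets ! 0 \<inter> all_sets ! i = {}"
proof -
  \<comment> \<open>The two matrices of the centre are scalar.\<close>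
  have "\<not> noncentral m" if "m \<in> set (all_mats ! 0)" for m
    using that by (auto simp: all_mats_def B_mats_def)
  then show ?thesis
    using all_mats_noncentral[OF assms] all_sets_rho(2)[OF assms(2)] all_sets_rho(2)[of 0] by (meson disjoint_iff zero_less_numeral)
qed

lemma all_sets_complete:
  assumes "i < 32"
  shows "commuting_graph BI120 (all_sets ! i) \<simeq>\<^sub>g K\<^bsub>length (all_mats ! i)\<^esub>"
proof (rule commuting_graph_complete)
  show "x \<cdot> y = y \<cdot> x" if "x \<in> all_sets ! i" "y \<in> all_sets ! i" for x y
  proof (cases "i = 0")
    case True
    then show ?thesis using all_sets_central[of 0 x y] that by simp
  next
    case False
    then show ?thesis using all_sets_commute_iff[of i i x y] that assms by simp
  qed
qed (simp_all add: assms finite_all_sets card_all_sets)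

text \<open>Serves each block of consecutive indices with equal class size; \<open>0 < a\<close>
  keeps the centre out.\<close>

lemma all_sets_copies:
  assumes "0 < a" "a + k \<le> 32" "\<And>i. i < k \<Longrightarrow> length (all_mats ! (a + i)) = m"
  shows "commuting_graph BI120 (\<Union>i\<in>{a..<a + k}. all_sets ! i) \<simeq>\<^sub>g k \<odot>\<^sub>g K\<^bsub>m\<^esub>"
proof -
  have "commuting_graph BI120 (\<Union>i<k. all_sets ! (a + i)) \<simeq>\<^sub>g k \<odot>\<^sub>g K\<^bsub>m\<^esub>"
  proof (rule commuting_graph_copies)
    show "x \<cdot> y = y \<cdot> x" if "i < k" "x \<in> all_sets ! (a + i)" "y \<in> all_sets ! (a + i)" for i x y
      using all_sets_commute_iff[of "a + i" "a + i"] that assms(1,2) by simp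
    show "i = j" if "i < k" "j < k" "x \<in> all_sets ! (a + i)" "y \<in> all_sets ! (a + j)"
      "x \<cdot> y = y \<cdot> x" for i j x y
      using all_sets_commute_iff[of "a + i" "a + j"] that assms(1,2) by simp
  qed (use assms in \<open>simp_all add: finite_all_sets card_all_sets\<close>)
  moreover have "{a..<a + k} = (+) a ` {..<k}"
    by (simp add: lessThan_atLeast0 add.commute)
  ultimately show ?thesis by simp
qed

section \<open>Assembling the blocks of equal class size\<close>

lemma length_nth_all_mats:
  "i < 16 \<Longrightarrow> length (all_mats ! i) = 2"
  "i < 10 \<Longrightarrow> length (all_mats ! (16 + i)) = 4"
  "i < 6 \<Longrightarrow> length (all_mats ! (26 + i)) = 8"
proof -
  have B: "list_all (\<lambda>A. length A = 2) B_mats" and C: "list_all (\<lambda>A. length A = 4) C_mats"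
    and D: "list_all (\<lambda>A. length A = 8) D_mats"
    by (simp_all add: B_mats_def C_mats_def D_mats_def)
  show "i < 16 \<Longrightarrow> length (all_mats ! i) = 2"
    using B by (simp add: all_mats_def nth_append length_mats list_all_length)
  show "i < 10 \<Longrightarrow> length (all_mats ! (16 + i)) = 4"
    using C by (simp add: all_mats_def nth_append length_mats list_all_length)
  show "i < 6 \<Longrightarrow> length (all_mats ! (26 + i)) = 8"
    using D by (simp add: all_mats_def nth_append length_mats list_all_length)
qed

lemma sets_nth_all_sets:
  "i \<in> {1..16} \<Longrightarrow> B_set i = all_sets ! (i - 1)"
  "i \<in> {1..10} \<Longrightarrow> C_set i = all_sets ! (16 + (i - 1))"
  "i \<in> {1..6} \<Longrightarrow> D_set i = all_sets ! (26 + (i - 1))"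
  by (auto simp: B_set_def C_set_def D_set_def all_sets_def nth_append length_sets)

lemma carrier_BI120_decomposition:
  "carrier BI120 = all_sets ! 0 \<union> ((\<Union>i\<in>{1..<16}. all_sets ! i) \<union> (\<Union>i\<in>{16..<26}. all_sets ! i) \<union>
     (\<Union>i\<in>{26..<32}. all_sets ! i))"
proof -
  have "{..<32} = {0::nat} \<union> {1..<16} \<union> {16..<26} \<union> {26..<32}" by auto
  then show ?thesis unfolding Union_all_sets[symmetric] by (simp only: UN_Un) auto
qed

theorem proposition4p4:
  shows "(\<forall>i\<in>{1..16}. commuting_graph BI120 (B_set i) \<simeq>\<^sub>g K\<^bsub>2\<^esub>) \<and>
         (\<forall>i\<in>{1..10}. commuting_graph BI120 (C_set i) \<simeq>\<^sub>g K\<^bsub>4\<^esub>) \<and>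
         (\<forall>i\<in>{1..6}. commuting_graph BI120 (D_set i) \<simeq>\<^sub>g K\<^bsub>8\<^esub>) \<and>
         commuting_graph BI120 (carrier BI120) \<simeq>\<^sub>g
           K\<^bsub>2\<^esub> \<or>\<^sub>g (15 \<odot>\<^sub>g K\<^bsub>2\<^esub> \<union>\<^sub>g 10 \<odot>\<^sub>g K\<^bsub>4\<^esub> \<union>\<^sub>g 6 \<odot>\<^sub>g K\<^bsub>8\<^esub>)"
proof (intro conjI ballI)
  show "commuting_graph BI120 (B_set i) \<simeq>\<^sub>g K\<^bsub>2\<^esub>" if "i \<in> {1..16}" for i
    using all_sets_complete[of "i - 1"] length_nth_all_mats(1)[of "i - 1"] that
    by (auto simp: sets_nth_all_sets)
  show "commuting_graph BI120 (C_set i) \<simeq>\<^sub>g K\<^bsub>4\<^esub>" if "i \<in> {1..10}" for i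
    using all_sets_complete[of "16 + (i - 1)"] length_nth_all_mats(2)[of "i - 1"] that
    by (auto simp: sets_nth_all_sets)
  show "commuting_graph BI120 (D_set i) \<simeq>\<^sub>g K\<^bsub>8\<^esub>" if "i \<in> {1..6}" for i
    using all_sets_complete[of "26 + (i - 1)"] length_nth_all_mats(3)[of "i - 1"] that
    by (auto simp: sets_nth_all_sets)
  let ?B = "\<Union>i\<in>{1..<16}. all_sets ! i" and ?C = "\<Union>i\<in>{16..<26}. all_sets ! i"
    and ?D = "\<Union>i\<in>{26..<32}. all_sets ! i"
  have A: "commuting_graph BI120 (all_sets ! 0) \<simeq>\<^sub>g K\<^bsub>2\<^esub>"
    using all_sets_complete[of 0] by (simp add: length_nth_all_mats)
  have B: "commuting_graph BI120 ?B \<simeq>\<^sub>g 15 \<odot>\<^sub>g K\<^bsub>2\<^esub>"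
    using all_sets_copies[of 1 15 2] by (simp add: length_nth_all_mats)
  have C: "commuting_graph BI120 ?C \<simeq>\<^sub>g 10 \<odot>\<^sub>g K\<^bsub>4\<^esub>"
    using all_sets_copies[of 16 10 4] by (simp add: length_nth_all_mats)
  have D: "commuting_graph BI120 ?D \<simeq>\<^sub>g 6 \<odot>\<^sub>g K\<^bsub>8\<^esub>"
    using all_sets_copies[of 26 6 8] by (simp add: length_nth_all_mats)
  \<comment> \<open>The lower end 1 excludes the centre, and the cut at \<open>b\<close> makes the
    two indices different.\<close>
  have neq: "x \<cdot> y \<noteq> y \<cdot> x" if x: "x \<in> (\<Union>i\<in>{1..<b}. all_sets ! i)" and y: "y \<in> (\<Union>i\<in>{b..<c}. all_sets ! i)"
      and c: "c \<le> 32" for x y b c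
  proof -
    obtain i j where "i \<in> {1..<b}" "j \<in> {b..<c}" "x \<in> all_sets ! i" "y \<in> all_sets ! j"
      using x y by blast
    then show ?thesis using all_sets_commute_iff[of i j x y] c by simp
  qed
  have BC: "commuting_graph BI120 (?B \<union> ?C) \<simeq>\<^sub>g 15 \<odot>\<^sub>g K\<^bsub>2\<^esub> \<union>\<^sub>g 10 \<odot>\<^sub>g K\<^bsub>4\<^esub>"
  proof (rule commuting_graph_union[OF B C])
    show "x \<cdot> y \<noteq> y \<cdot> x" if "x \<in> ?B" "y \<in> ?C" for x y
      using neq[OF that] by simp
    \<comment> \<open>A common element would fail to commute with itself.\<close>
    then show "?B \<inter> ?C = {}" by blast
  qed
  have BCD: "commuting_graph BI120 (?B \<union> ?C \<union> ?D) \<simeq>\<^sub>g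
      15 \<odot>\<^sub>g K\<^bsub>2\<^esub> \<union>\<^sub>g 10 \<odot>\<^sub>g K\<^bsub>4\<^esub> \<union>\<^sub>g 6 \<odot>\<^sub>g K\<^bsub>8\<^esub>"
  proof (rule commuting_graph_union[OF BC D])
    \<comment> \<open>Merging both blocks into one range of indices allows \<open>neq\<close> to be
      used with the cut 26.\<close>
    have "{1..<26} = {1..<16} \<union> {16..<26::nat}" by auto
    then have "?B \<union> ?C = (\<Union>i\<in>{1..<26}. all_sets ! i)" by (simp only: UN_Un)
    then show "x \<cdot> y \<noteq> y \<cdot> x" if "x \<in> ?B \<union> ?C" "y \<in> ?D" for x y
      using neq[of x 26 y 32] that by simp
    then show "(?B \<union> ?C) \<inter> ?D = {}" by blast
  qed
  have mem: "\<exists>i. 0 < i \<and> i < 32 \<and> x \<in> all_sets ! i" if x: "x \<in> ?B \<union> ?C \<union> ?D" for x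
  proof -
    obtain i where i: "i \<in> {1..<16} \<union> {16..<26} \<union> {26..<32}" "x \<in> all_sets ! i"
      using x by blast
    then have "0 < i \<and> i < 32" by auto
    with i(2) show ?thesis by blast
  qed
  show "commuting_graph BI120 (carrier BI120) \<simeq>\<^sub>g
      K\<^bsub>2\<^esub> \<or>\<^sub>g (15 \<odot>\<^sub>g K\<^bsub>2\<^esub> \<union>\<^sub>g 10 \<odot>\<^sub>g K\<^bsub>4\<^esub> \<union>\<^sub>g 6 \<odot>\<^sub>g K\<^bsub>8\<^esub>)"
    unfolding carrier_BI120_decomposition
  proof (rule commuting_graph_join[OF A BCD])
    show "all_sets ! 0 \<inter> (?B \<union> ?C \<union> ?D) = {}"
      using all_sets_disjoint mem by blast
    show "x \<cdot> y = y \<cdot> x" if "x \<in> all_sets ! 0" "y \<in> ?B \<union> ?C \<union> ?D" for x y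
      using mem[OF that(2)] all_sets_central that(1) by blast
  qed
qed

end
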